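(* Let $W$ be a finite Coxeter group with Coxeter generators $s_1,\ldots,s_n$, and assume that $W$ is not of type $A_1$ and not of type $I_2(m)$ with $m$ odd, $m\ge 3$. Let $P$ be a doubly stochastic matrix and let $(X_k)_{k\ge 0}$ be the random walk $\mathbf{RW}(W,P)$. Then $$\lim_{k\to\infty}\mathbb{E}\big[\ell_{\widetilde W}(\widetilde X_k)\big]=\frac{\mathrm{Ref}\,W}{2},$$ where $\mathrm{Ref}\,W$ is the number of reflections of $W$, which is equal to the length of the longest element of $W$.
   Context: A Coxeter group $W$ is a group given by a presentation $\langle s_1,\ldots,s_n\mid (s_is_j)^{m(i,j)}=1\rangle$ with $m(i,i)=1$ and $m(i,j)=m(j,i)\in\{2,3,\ldots\}\cup\{\infty\}$ for $i\ne j$. The type of $W$ refers to this presentation: type $A_1$ is $\langle s_1\mid s_1^2=1\rangle$, and type $I_2(m)$ is $\langle s_1,s_2\mid s_1^2=s_2^2=(s_1s_2)^m=1\rangle$ (in particular $A_2=I_2(3)$). The reflections of $W$ are the conjugates of the generators $s_i$, and $\mathrm{Ref}\,W$ is their number. The length $\ell_W(w)$ is the smallest $r$ such that $w$ is a product of $r$ generators, with $\ell_W(1)=0$. Such an expression of minimal length is called reduced. The Artin–Tits braid group $\widetilde W$ of $W$ is the group with generators $\sigma_1,\ldots,\sigma_n$ and relations $\sigma_i\sigma_j\sigma_i\cdots=\sigma_j\sigma_i\sigma_j\cdots$ with $m(i,j)$ factors on each side, for $i\neq j$ with $m(i,j)<\infty$. The length $\ell_{\widetilde W}(\beta)$ is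 the smallest $r$ such that $\beta$ is a product of $r$ elements of $\{\sigma_1^{\pm1},\ldots,\sigma_n^{\pm1}\}$, with the identity having length $0$. The lift $w\mapsto\widetilde w$ from $W$ to $\widetilde W$ is defined by $\widetilde w=\sigma_{i_1}\cdots\sigma_{i_r}$ whenever $w=s_{i_1}\cdots s_{i_r}$ is a reduced expression. By Matsumoto's theorem it is well defined. It is not a homomorphism in general. The random walk $\mathbf{RW}(W,P)$ is a (time-homogeneous) Markov chain $X_0,X_1,\ldots$ with state space $W$, with $X_0=1$ (the identity) almost surely, and with transition matrix $P=(p_{ab})_{a,b\in W}$ such that $p_{ab}>0$ whenever $b=as_i$ for some $i$. A matrix is doubly stochastic if its entries are nonnegative and all its row sums and column sums equal $1$. *)

theory Defs
  imports "HOL-Probability.Probability" "HOL-Library.Extended_Nat" "HOL-Algebra.Group"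
begin

section \<open>Groups given by generators and relators\<close>

text \<open>A letter \<open>(i, True)\<close> stands for the generator with index \<open>i\<close>, and \<open>(i, False)\<close> for its
  formal inverse.\<close>

type_synonym letter = "nat \<times> bool"

definition words :: "nat set \<Rightarrow> letter list set" where
  "words I = lists (I \<times> UNIV)"

definition inv_word :: "letter list \<Rightarrow> letter list" where
  "inv_word u = rev (map (\<lambda>(i, e). (i, \<not> e)) u)"

inductive word_eq :: "nat set \<Rightarrow> letter list set \<Rightarrow> letter list \<Rightarrow> letter list \<Rightarrow> bool"
  for I :: "nat set" and R :: "letter list set" where
  refl: "u \<in> words I \<Longrightarrow> word_eq I R u u"
| sym: "word_eq I R u v \<Longrightarrow> word_eq I R v u"
| trans: "word_eq I R u v \<Longrightarrow> word_eq I R v w \<Longrightarrow> word_eq I R u w"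
| cancel: "u \<in> words I \<Longrightarrow> v \<in> words I \<Longrightarrow> i \<in> I \<Longrightarrow>
    word_eq I R (u @ [(i, e), (i, \<not> e)] @ v) (u @ v)"
| relator: "u \<in> words I \<Longrightarrow> v \<in> words I \<Longrightarrow> r \<in> R \<Longrightarrow> r \<in> words I \<Longrightarrow>
    word_eq I R (u @ r @ v) (u @ v)"

definition word_rel :: "nat set \<Rightarrow> letter list set \<Rightarrow> letter list rel" where
  "word_rel I R = {(u, v). word_eq I R u v}"

definition presented_group :: "nat set \<Rightarrow> letter list set \<Rightarrow> letter list set monoid" where
  "presented_group I R =
    \<lparr>carrier = words I // word_rel I R,
     mult = (\<lambda>A B. \<Union>u\<in>A. \<Union>v\<in>B. word_rel I R `` {u @ v}),
     one = word_rel I R `` {[]}\<rparr>"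

definition generator :: "nat set \<Rightarrow> letter list set \<Rightarrow> nat \<Rightarrow> letter list set" where
  "generator I R i = word_rel I R `` {[(i, True)]}"

lemma word_eq_words: "word_eq I R u v \<Longrightarrow> u \<in> words I \<and> v \<in> words I"
  by (induction rule: word_eq.induct) (auto simp: words_def)

lemma word_eq_context:
  "word_eq I R u v \<Longrightarrow> x \<in> words I \<Longrightarrow> y \<in> words I \<Longrightarrow> word_eq I R (x @ u @ y) (x @ v @ y)"
proof (induction rule: word_eq.induct)
  case (refl u)
  then show ?case by (intro word_eq.refl) (auto simp: words_def)
next
  case (cancel u v i e)
  then show ?case using word_eq.cancel[of "x @ u" I "v @ y" i R e] by (auto simp: words_def)
next
  case (relator u v r)
  then show ?case using word_eq.relator[of "x @ u" I "v @ y" r R] by (auto simp: words_def)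
qed (blast intro: word_eq.sym word_eq.trans)+

lemma word_eq_append:
  assumes "word_eq I R u u'" "word_eq I R v v'"
  shows "word_eq I R (u @ v) (u' @ v')"
proof -
  have w: "u' \<in> words I" "v \<in> words I" "[] \<in> words I"
    using assms word_eq_words by (auto simp: words_def)
  show ?thesis
    using word_eq_context[OF assms(1) w(3) w(2)] word_eq_context[OF assms(2) w(1) w(3)]
    by (simp add: word_eq.trans)
qed

lemma equiv_word_rel: "equiv (words I) (word_rel I R)"
  by (intro equivI)
    (auto simp: word_rel_def refl_on_def sym_def trans_def
      dest: word_eq_words intro: word_eq.intros)

lemma word_eq_inv_word: "u \<in> words I \<Longrightarrow> word_eq I R (inv_word u @ u) []"
proof (induction u)
  case Nil
  then show ?case by (auto simp: inv_word_def words_def intro: word_eq.refl)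
next
  case (Cons a u)
  obtain i e where a: "a = (i, e)" by (cases a)
  have w: "u \<in> words I" "i \<in> I" "inv_word u \<in> words I"
    using Cons.prems by (auto simp: a words_def inv_word_def)
  have "word_eq I R (inv_word u @ [(i, \<not> e), (i, e)] @ u) (inv_word u @ u)"
    using word_eq.cancel[OF w(3) w(1) w(2), of R "\<not> e"] by simp
  then show ?case using Cons.IH[OF w(1)] by (auto simp: a inv_word_def intro: word_eq.trans)
qed

lemma presented_group_mult:
  assumes "u \<in> words I" "v \<in> words I"
  shows "word_rel I R `` {u} \<otimes>\<^bsub>presented_group I R\<^esub> word_rel I R `` {v} = word_rel I R `` {u @ v}"
  using assms
  by (auto simp: presented_group_def word_rel_def
      intro: word_eq.refl word_eq.trans word_eq_append)

lemma group_presented_group: "group (presented_group I R)"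
proof -
  have C: "carrier (presented_group I R) = (\<lambda>u. word_rel I R `` {u}) ` words I"
    by (auto simp: presented_group_def quotient_def)
  have one: "\<one>\<^bsub>presented_group I R\<^esub> = word_rel I R `` {[]}"
    by (simp add: presented_group_def)
  have W: "[] \<in> words I" "\<And>u v. u \<in> words I \<Longrightarrow> v \<in> words I \<Longrightarrow> u @ v \<in> words I"
    "\<And>u. u \<in> words I \<Longrightarrow> inv_word u \<in> words I"
    by (auto simp: words_def inv_word_def)
  show ?thesis
  proof (rule groupI)
    fix x assume "x \<in> carrier (presented_group I R)"
    then obtain u where u: "u \<in> words I" "x = word_rel I R `` {u}" by (auto simp: C)
    have "word_rel I R `` {inv_word u} \<otimes>\<^bsub>presented_group I R\<^esub> x = word_rel I R `` {inv_word u @ u}"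
      using u by (simp add: presented_group_mult W)
    also have "\<dots> = \<one>\<^bsub>presented_group I R\<^esub>"
      using word_eq_inv_word[OF u(1), of R] unfolding one
      by (intro equiv_class_eq[OF equiv_word_rel]) (simp add: word_rel_def)
    finally show "\<exists>y\<in>carrier (presented_group I R). y \<otimes>\<^bsub>presented_group I R\<^esub> x = \<one>\<^bsub>presented_group I R\<^esub>"
      using u W by (auto simp: C)
  qed (auto simp: C one presented_group_mult W)
qed

definition list_prod :: "('a, 'b) monoid_scheme \<Rightarrow> 'a list \<Rightarrow> 'a" where
  "list_prod G xs = foldr (mult G) xs (one G)"

definition length_wrt :: "('a, 'b) monoid_scheme \<Rightarrow> 'a set \<Rightarrow> 'a \<Rightarrow> nat" where
  "length_wrt G S g = (LEAST r. \<exists>xs. set xs \<subseteq> S \<and> length xs = r \<and> list_prod G xs = g)"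


section \<open>Coxeter groups and Artin--Tits braid groups\<close>

text \<open>Only the values \<open>m i j\<close> with \<open>i\<close>, \<open>j\<close> in \<open>{1..n}\<close> matter.\<close>

definition coxeter_matrix :: "nat \<Rightarrow> (nat \<Rightarrow> nat \<Rightarrow> enat) \<Rightarrow> bool" where
  "coxeter_matrix n m \<longleftrightarrow>
    (\<forall>i\<in>{1..n}. m i i = 1) \<and>
    (\<forall>i\<in>{1..n}. \<forall>j\<in>{1..n}. i \<noteq> j \<longrightarrow> m i j = m j i \<and> 2 \<le> m i j)"

definition coxeter_relators :: "nat \<Rightarrow> (nat \<Rightarrow> nat \<Rightarrow> enat) \<Rightarrow> letter list set" where
  "coxeter_relators n m =
    {concat (replicate k [(i, True), (j, True)]) | i j k.
      i \<in> {1..n} \<and> j \<in> {1..n} \<and> m i j = enat k}"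

definition coxeter_group :: "nat \<Rightarrow> (nat \<Rightarrow> nat \<Rightarrow> enat) \<Rightarrow> letter list set monoid" where
  "coxeter_group n m = presented_group {1..n} (coxeter_relators n m)"

definition cox_gen :: "nat \<Rightarrow> (nat \<Rightarrow> nat \<Rightarrow> enat) \<Rightarrow> nat \<Rightarrow> letter list set" where
  "cox_gen n m i = generator {1..n} (coxeter_relators n m) i"

definition type_A1 :: "nat \<Rightarrow> (nat \<Rightarrow> nat \<Rightarrow> enat) \<Rightarrow> bool" where
  "type_A1 n m \<longleftrightarrow> coxeter_matrix n m \<and> n = 1"

definition type_I2 :: "nat \<Rightarrow> nat \<Rightarrow> (nat \<Rightarrow> nat \<Rightarrow> enat) \<Rightarrow> bool" where
  "type_I2 k n m \<longleftrightarrow> coxeter_matrix n m \<and> n = 2 \<and> m 1 2 = enat k"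

definition reflections :: "nat \<Rightarrow> (nat \<Rightarrow> nat \<Rightarrow> enat) \<Rightarrow> letter list set set" where
  "reflections n m =
    {g \<otimes>\<^bsub>coxeter_group n m\<^esub> cox_gen n m i \<otimes>\<^bsub>coxeter_group n m\<^esub> inv\<^bsub>coxeter_group n m\<^esub> g | g i.
      g \<in> carrier (coxeter_group n m) \<and> i \<in> {1..n}}"

definition cox_length :: "nat \<Rightarrow> (nat \<Rightarrow> nat \<Rightarrow> enat) \<Rightarrow> letter list set \<Rightarrow> nat" where
  "cox_length n m w = length_wrt (coxeter_group n m) (cox_gen n m ` {1..n}) w"

text \<open>The alternating word with \<open>k\<close> letters that starts with \<open>i\<close>.\<close>

definition alt_word :: "nat \<Rightarrow> nat \<Rightarrow> nat \<Rightarrow> letter list" where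
  "alt_word k i j = map (\<lambda>t. (if even t then i else j, True)) [0..<k]"

definition braid_relators :: "nat \<Rightarrow> (nat \<Rightarrow> nat \<Rightarrow> enat) \<Rightarrow> letter list set" where
  "braid_relators n m =
    {alt_word k i j @ inv_word (alt_word k j i) | i j k.
      i \<in> {1..n} \<and> j \<in> {1..n} \<and> i \<noteq> j \<and> m i j = enat k}"

definition braid_group :: "nat \<Rightarrow> (nat \<Rightarrow> nat \<Rightarrow> enat) \<Rightarrow> letter list set monoid" where
  "braid_group n m = presented_group {1..n} (braid_relators n m)"

definition braid_gen :: "nat \<Rightarrow> (nat \<Rightarrow> nat \<Rightarrow> enat) \<Rightarrow> nat \<Rightarrow> letter list set" where
  "braid_gen n m i = generator {1..n} (braid_relators n m) i"

definition braid_length :: "nat \<Rightarrow> (nat \<Rightarrow> nat \<Rightarrow> enat) \<Rightarrow> letter list set \<Rightarrow> nat" where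
  "braid_length n m b =
    length_wrt (braid_group n m)
      (braid_gen n m ` {1..n} \<union> (\<lambda>i. inv\<^bsub>braid_group n m\<^esub> braid_gen n m i) ` {1..n}) b"

definition reduced_expr :: "nat \<Rightarrow> (nat \<Rightarrow> nat \<Rightarrow> enat) \<Rightarrow> nat list \<Rightarrow> letter list set \<Rightarrow> bool" where
  "reduced_expr n m is w \<longleftrightarrow>
    set is \<subseteq> {1..n} \<and> list_prod (coxeter_group n m) (map (cox_gen n m) is) = w \<and>
    length is = cox_length n m w"

text \<open>The description is proper by Matsumoto's theorem: all reduced expressions of \<open>w\<close> give the
  same element of the braid group.\<close>

definition braid_lift :: "nat \<Rightarrow> (nat \<Rightarrow> nat \<Rightarrow> enat) \<Rightarrow> letter list set \<Rightarrow> letter list set" where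
  "braid_lift n m w =
    (THE b. \<exists>is. reduced_expr n m is w \<and> b = list_prod (braid_group n m) (map (braid_gen n m) is))"


section \<open>Random walks\<close>

definition stochastic_on :: "'a set \<Rightarrow> ('a \<Rightarrow> 'a \<Rightarrow> real) \<Rightarrow> bool" where
  "stochastic_on A P \<longleftrightarrow>
    (\<forall>a\<in>A. \<forall>b\<in>A. 0 \<le> P a b) \<and> (\<forall>a\<in>A. ((\<lambda>b. P a b) has_sum 1) A)"

definition doubly_stochastic_on :: "'a set \<Rightarrow> ('a \<Rightarrow> 'a \<Rightarrow> real) \<Rightarrow> bool" where
  "doubly_stochastic_on A P \<longleftrightarrow>
    (\<forall>a\<in>A. \<forall>b\<in>A. 0 \<le> P a b) \<and> (\<forall>a\<in>A. ((\<lambda>b. P a b) has_sum 1) A) \<and>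
    (\<forall>b\<in>A. ((\<lambda>a. P a b) has_sum 1) A)"

definition markov_chain ::
  "'o measure \<Rightarrow> 'a set \<Rightarrow> 'a \<Rightarrow> ('a \<Rightarrow> 'a \<Rightarrow> real) \<Rightarrow> (nat \<Rightarrow> 'o \<Rightarrow> 'a) \<Rightarrow> bool" where
  "markov_chain M A x0 P X \<longleftrightarrow>
    prob_space M \<and> stochastic_on A P \<and>
    (\<forall>k. X k \<in> measurable M (count_space A)) \<and>
    (AE \<omega> in M. X 0 \<omega> = x0) \<and>
    (\<forall>k a b. (\<forall>i\<le>k. a i \<in> A) \<and> b \<in> A \<and> \<P>(\<omega> in M. \<forall>i\<le>k. X i \<omega> = a i) > 0 \<longrightarrow>
      \<P>(\<omega> in M. X (Suc k) \<omega> = b \<bar> \<forall>i\<le>k. X i \<omega> = a i) = P (a k) b)"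

definition random_walk ::
  "nat \<Rightarrow> (nat \<Rightarrow> nat \<Rightarrow> enat) \<Rightarrow> (letter list set \<Rightarrow> letter list set \<Rightarrow> real) \<Rightarrow>
   'o measure \<Rightarrow> (nat \<Rightarrow> 'o \<Rightarrow> letter list set) \<Rightarrow> bool" where
  "random_walk n m P M X \<longleftrightarrow>
    markov_chain M (carrier (coxeter_group n m)) \<one>\<^bsub>coxeter_group n m\<^esub> P X \<and>
    (\<forall>a\<in>carrier (coxeter_group n m). \<forall>i\<in>{1..n}.
      0 < P a (a \<otimes>\<^bsub>coxeter_group n m\<^esub> cox_gen n m i))"

end

theory Submission
  imports Defs
begin

text \<open>
  The lift preserves length.  By Matsumoto's theorem (lemma \<open>matsumoto\<close>) all reduced words of \<open>w\<close>
  are connected by braid moves, so the lift is the class of any of them; and no word for the lift has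
  fewer letters than \<open>w\<close>, because the projection to \<open>W\<close> does not change the number of letters (lemma
  \<open>braid_length_lift\<close>).  So the expectation in question is the expected Coxeter length of \<open>X\<^sub>k\<close>.

  A reflection \<open>t\<close> is an inversion of exactly one of \<open>w\<close> and \<open>t w\<close>, and \<open>\<ell>(w)\<close> is the number of
  inversions of \<open>w\<close>.  Hence the mean length over \<open>W\<close> is half the number of reflections (lemma
  \<open>sum_len\<close>), and this settles the case of an aperiodic walk, since a doubly stochastic matrix
  spreads the walk uniformly.  But every transition may change the parity of the length.  Then the walk
  spreads alternately over the elements of even and of odd length, and both classes need the same
  mean length; that is, \<open>\<Sum>\<^sub>w (-1)\<^sup>\<ell>\<^sup>(\<^sup>w\<^sup>) \<ell>(w) = 0\<close> is needed (lemma \<open>sum_sgn_len_mult_len\<close>).  Translation by \<open>s\<^sub>i\<close>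
  reduces this to \<open>\<Sum>\<^sub>w (-1)\<^sup>\<ell>\<^sup>(\<^sup>w\<^sup>) (\<ell>(s\<^sub>i w) - \<ell>(w)) = 0\<close>.  If \<open>m i j\<close> is even for some \<open>j\<close>, the
  longest element of the dihedral group of \<open>s\<^sub>i\<close> and \<open>s\<^sub>j\<close> has even length and commutes with \<open>s\<^sub>i\<close>, and
  translation by it exchanges the elements with and without the left descent \<open>s\<^sub>i\<close>.

  Such a pair exists outside the excluded types (lemma \<open>even_pair\<close>).  In rank at least three two of
  the first three generators commute: otherwise \<open>s\<^sub>1 s\<^sub>2 s\<^sub>3 s\<^sub>1 s\<^sub>2 s\<^sub>3 \<cdots>\<close> never admits a braid move, so by
  Matsumoto's theorem all its prefixes are reduced and \<open>W\<close> is infinite.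

  The facts on Coxeter groups are derived from the presentation.  The exchange condition, the inversions
  and the longest element come from the invariance of the parity with which a word crosses a wall
  (lemma \<open>odd_crossing_invariant\<close>).  Matsumoto's theorem and the dihedral argument also need that
  \<open>s\<^sub>i s\<^sub>j\<close> does not have smaller order than \<open>m i j\<close>, which the numbers game shows (lemma
  \<open>order_s_mult_s\<close>).  The convergence of the walk is a contraction argument (lemma
  \<open>doubly_stochastic_powers_vanish\<close>).
\<close>

section \<open>Words and presented groups\<close>

text \<open>The index set of the generators is \<open>{1..n}\<close> throughout; this keeps the simplifier from
  rewriting its lower bound.\<close>

declare One_nat_def [simp del]

lemma word_class_eq_iff:
  assumes "u \<in> words I" "v \<in> words I"
  shows "word_rel I R `` {u} = word_rel I R `` {v} \<longleftrightarrow> word_eq I R u v"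
  using eq_equiv_class_iff[OF equiv_word_rel assms] by (simp add: word_rel_def)

lemma word_class_Nil: "word_rel I R `` {[]} = \<one>\<^bsub>presented_group I R\<^esub>"
  by (simp add: presented_group_def)

lemma word_class_in_carrier: "u \<in> words I \<Longrightarrow> word_rel I R `` {u} \<in> carrier (presented_group I R)"
  by (simp add: presented_group_def quotientI)

lemma list_prod_letter_classes:
  "u \<in> words I \<Longrightarrow>
    list_prod (presented_group I R) (map (\<lambda>l. word_rel I R `` {[l]}) u) = word_rel I R `` {u}"
proof (induction u)
  case Nil
  then show ?case by (simp add: list_prod_def word_class_Nil)
next
  case (Cons l u)
  then have "[l] \<in> words I" "u \<in> words I" by (auto simp: words_def)
  then show ?case using Cons.IH presented_group_mult[of "[l]" I u R] by (simp add: list_prod_def)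
qed

lemma inv_generator:
  assumes "i \<in> I"
  shows "inv\<^bsub>presented_group I R\<^esub> generator I R i = word_rel I R `` {[(i, False)]}"
proof -
  interpret group "presented_group I R" by (rule group_presented_group)
  have w: "[(i, e)] \<in> words I" "[] \<in> words I" for e
    using assms by (auto simp: words_def)
  have "word_eq I R ([] @ [(i, False), (i, \<not> False)] @ []) ([] @ [])"
    using assms by (intro word_eq.cancel) (auto simp: words_def)
  then have "word_rel I R `` {[(i, False), (i, True)]} = word_rel I R `` {[]}"
    using assms by (subst word_class_eq_iff) (auto simp: words_def)
  then have "word_rel I R `` {[(i, False)]} \<otimes>\<^bsub>presented_group I R\<^esub> generator I R i
      = \<one>\<^bsub>presented_group I R\<^esub>"
    using w by (simp add: generator_def presented_group_mult word_class_Nil)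
  then show ?thesis
    using w by (intro inv_equality) (auto simp: generator_def word_class_in_carrier)
qed

lemma word_eq_change_relators:
  assumes "word_eq I R u v" and "\<And>r. r \<in> R \<Longrightarrow> r \<in> words I \<Longrightarrow> word_eq I R' r []"
  shows "word_eq I R' u v"
  using assms(1)
proof induction
  case (relator u v r)
  then show ?case using word_eq_context[OF assms(2)[of r], of u v] by simp
qed (blast intro: word_eq.intros)+

lemma word_eq_action:
  fixes act :: "letter \<Rightarrow> 'x \<Rightarrow> 'x"
  assumes "word_eq I R u v"
    and "\<And>i e x. i \<in> I \<Longrightarrow> act (i, e) (act (i, \<not> e) x) = x"
    and "\<And>r x. r \<in> R \<Longrightarrow> foldr act r x = x"
  shows "foldr act u = foldr act v"
  using assms(1) by induction (auto simp: fun_eq_iff assms(2,3))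

lemma length_wrt_le: "set xs \<subseteq> S \<Longrightarrow> list_prod G xs = g \<Longrightarrow> length_wrt G S g \<le> length xs"
  unfolding length_wrt_def by (rule Least_le) blast

lemma length_wrt_witness:
  assumes "set xs \<subseteq> S" "list_prod G xs = g"
  obtains ys where "set ys \<subseteq> S" "list_prod G ys = g" "length ys = length_wrt G S g"
  using LeastI[of "\<lambda>r. \<exists>xs. set xs \<subseteq> S \<and> length xs = r \<and> list_prod G xs = g" "length xs"] assms that
  unfolding length_wrt_def by blast

section \<open>Alternating words\<close>

definition alternating :: "nat \<Rightarrow> 'a \<Rightarrow> 'a \<Rightarrow> 'a list" where
  "alternating k i j = map (\<lambda>t. if even t then i else j) [0..<k]"

lemma length_alternating [simp]: "length (alternating k i j) = k"
  by (simp add: alternating_def)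

lemma alternating_0 [simp]: "alternating 0 i j = []"
  by (simp add: alternating_def)

lemma alternating_Suc: "alternating (Suc k) i j = i # alternating k j i"
  by (rule nth_equalityI) (auto simp: alternating_def nth_Cons split: nat.split simp del: upt_Suc)

lemma set_alternating: "set (alternating k i j) \<subseteq> {i, j}"
  by (auto simp: alternating_def)

lemma alternating_append_rev:
  "alternating k i j @ rev (alternating k j i) = alternating (2 * k) i j"
  by (rule nth_equalityI) (auto simp: alternating_def nth_append rev_nth)

lemma alternating_eq_concat: "alternating (2 * k) i j = concat (replicate k [i, j])"
  by (induction k) (auto simp: alternating_Suc)

section \<open>Coxeter groups\<close>

locale coxeter =
  fixes n :: nat and m :: "nat \<Rightarrow> nat \<Rightarrow> enat"
  assumes coxeter_matrix: "coxeter_matrix n m"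
begin

abbreviation "W \<equiv> coxeter_group n m"
abbreviation "s \<equiv> cox_gen n m"
abbreviation "len \<equiv> cox_length n m"
abbreviation "cox_eq \<equiv> word_eq {1..n} (coxeter_relators n m)"
abbreviation cox_mult (infixl "\<star>" 70) where "x \<star> y \<equiv> x \<otimes>\<^bsub>W\<^esub> y"
abbreviation "cox_class u \<equiv> word_rel {1..n} (coxeter_relators n m) `` {u}"

sublocale group W
  unfolding coxeter_group_def by (rule group_presented_group)

lemma m_diag: "i \<in> {1..n} \<Longrightarrow> m i i = 1"
  and m_sym: "i \<in> {1..n} \<Longrightarrow> j \<in> {1..n} \<Longrightarrow> m i j = m j i"
  and m_ge_2: "i \<in> {1..n} \<Longrightarrow> j \<in> {1..n} \<Longrightarrow> i \<noteq> j \<Longrightarrow> 2 \<le> m i j"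
  using coxeter_matrix unfolding coxeter_matrix_def by (cases "i = j"; simp; fail)+

definition elt :: "nat list \<Rightarrow> letter list set" where
  "elt u = list_prod W (map s u)"

lemma s_eq_class: "s i = cox_class [(i, True)]"
  by (simp add: cox_gen_def generator_def)

lemma s_closed [simp]: "i \<in> {1..n} \<Longrightarrow> s i \<in> carrier W"
  by (auto simp: s_eq_class coxeter_group_def words_def intro!: word_class_in_carrier)

lemma relator_class:
  assumes "i \<in> {1..n}" "j \<in> {1..n}" "m i j = enat k"
  shows "cox_eq (concat (replicate k [(i, True), (j, True)])) []"
proof -
  have "set (concat (replicate k [(i, True), (j, True)])) \<subseteq> {(i, True), (j, True)}" by auto
  then have "concat (replicate k [(i, True), (j, True)]) \<in> words {1..n}"
    using assms by (auto simp: words_def)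
  then show ?thesis
    using word_eq.relator[of "[]" "{1..n}" "[]" "concat (replicate k [(i, True), (j, True)])"
        "coxeter_relators n m"] assms
    by (auto simp: coxeter_relators_def words_def)
qed

lemma s_square [simp]:
  assumes "i \<in> {1..n}" shows "s i \<star> s i = \<one>\<^bsub>W\<^esub>"
proof -
  have w: "[(i, True)] \<in> words {1..n}" "[(i, True), (i, True)] \<in> words {1..n}" "[] \<in> words {1..n}"
    using assms by (auto simp: words_def)
  have "cox_eq [(i, True), (i, True)] []"
    using relator_class[of i i 1] assms m_diag[of i] by (simp add: one_enat_def One_nat_def)
  then have "cox_class [(i, True), (i, True)] = \<one>\<^bsub>W\<^esub>"
    using w word_class_eq_iff word_class_Nil unfolding coxeter_group_def by metis
  then show ?thesis
    using w presented_group_mult[of "[(i, True)]" "{1..n}" "[(i, True)]" "coxeter_relators n m"]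
    by (simp add: s_eq_class coxeter_group_def)
qed

lemma inv_s [simp]: "i \<in> {1..n} \<Longrightarrow> inv\<^bsub>W\<^esub> s i = s i"
  by (rule inv_equality) auto

lemma s_s_mult [simp]: "i \<in> {1..n} \<Longrightarrow> x \<in> carrier W \<Longrightarrow> s i \<star> (s i \<star> x) = x"
  by (simp flip: m_assoc)

lemma elt_Nil [simp]: "elt [] = \<one>\<^bsub>W\<^esub>"
  and elt_Cons [simp]: "elt (i # u) = s i \<star> elt u"
  by (simp_all add: elt_def list_prod_def)

lemma elt_closed [simp]: "set u \<subseteq> {1..n} \<Longrightarrow> elt u \<in> carrier W"
  by (induction u) auto

lemma elt_append [simp]:
  "set u \<subseteq> {1..n} \<Longrightarrow> set v \<subseteq> {1..n} \<Longrightarrow> elt (u @ v) = elt u \<star> elt v"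
  by (induction u) (auto simp: m_assoc)

lemma elt_rev: "set u \<subseteq> {1..n} \<Longrightarrow> elt (rev u) = inv\<^bsub>W\<^esub> elt u"
  by (induction u) (auto simp: inv_mult_group)

lemma letter_class: "i \<in> {1..n} \<Longrightarrow> cox_class [(i, e)] = s i"
  using inv_generator[of i "{1..n}" "coxeter_relators n m"] inv_s[of i]
  by (cases e) (auto simp: s_eq_class coxeter_group_def generator_def)

lemma class_eq_elt:
  assumes "u \<in> words {1..n}" shows "cox_class u = elt (map fst u)"
proof -
  have "cox_class [l] = s (fst l)" if "l \<in> set u" for l
  proof -
    have "fst l \<in> {1..n}" using assms that by (force simp: words_def)
    then show ?thesis using letter_class[of "fst l" "snd l"] by simp
  qed
  then have "map (\<lambda>l. cox_class [l]) u = map s (map fst u)"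
    unfolding map_map by (intro map_cong) (simp_all only: comp_def)
  then show ?thesis
    using list_prod_letter_classes[OF assms, of "coxeter_relators n m"]
    unfolding elt_def coxeter_group_def by metis
qed

lemma cox_eq_iff:
  assumes "u \<in> words {1..n}" "v \<in> words {1..n}"
  shows "cox_eq u v \<longleftrightarrow> elt (map fst u) = elt (map fst v)"
  using word_class_eq_iff[OF assms] class_eq_elt assms by metis

lemma cox_eq_positive:
  assumes "set u \<subseteq> {1..n}" "set v \<subseteq> {1..n}" "elt u = elt v"
  shows "cox_eq (map (\<lambda>i. (i, True)) u) (map (\<lambda>i. (i, True)) v)"
  using assms by (subst cox_eq_iff) (auto simp: words_def comp_def)

lemma carrier_elt:
  assumes "w \<in> carrier W"
  obtains u where "set u \<subseteq> {1..n}" "elt u = w"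
proof -
  obtain x where "x \<in> words {1..n}" "w = cox_class x"
    using assms by (auto simp: coxeter_group_def presented_group_def quotient_def)
  moreover from this have "set (map fst x) \<subseteq> {1..n}" by (auto simp: words_def)
  ultimately show ?thesis using class_eq_elt[of x] that[of "map fst x"] by simp
qed

lemma elt_alternating:
  assumes "i \<in> {1..n}" "j \<in> {1..n}"
  shows "elt (alternating (2 * k) i j) = (s i \<star> s j) [^]\<^bsub>W\<^esub> k"
proof (induction k)
  case (Suc k)
  have "set (alternating (2 * k) i j) \<subseteq> {1..n}" using assms set_alternating by fastforce
  then show ?case using assms Suc nat_pow_Suc2[of "s i \<star> s j" k] by (simp add: alternating_Suc m_assoc del: nat_pow_Suc)
qed simp

lemma s_mult_pow_m:
  assumes "i \<in> {1..n}" "j \<in> {1..n}" "m i j = enat k"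
  shows "(s i \<star> s j) [^]\<^bsub>W\<^esub> k = \<one>\<^bsub>W\<^esub>"
proof -
  let ?r = "concat (replicate k [(i, True), (j, True)])"
  have "map fst ?r = alternating (2 * k) i j"
    by (simp add: alternating_eq_concat map_concat)
  moreover have "set ?r \<subseteq> {(i, True), (j, True)}" by auto
  then have "?r \<in> words {1..n}" "[] \<in> words {1..n}" using assms by (auto simp: words_def)
  ultimately show ?thesis
    using relator_class[OF assms] elt_alternating[OF assms(1,2), of k] by (simp add: cox_eq_iff)
qed

lemma elt_braid:
  assumes "i \<in> {1..n}" "j \<in> {1..n}" "m i j = enat k"
  shows "elt (alternating k i j) = elt (alternating k j i)"
proof -
  have w: "set (alternating k i j) \<subseteq> {1..n}" "set (alternating k j i) \<subseteq> {1..n}"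
    using assms set_alternating by fastforce+
  have "elt (alternating k i j) \<star> elt (rev (alternating k j i)) = \<one>\<^bsub>W\<^esub>"
    using w elt_append[of "alternating k i j" "rev (alternating k j i)"]
      s_mult_pow_m[OF assms] elt_alternating[OF assms(1,2), of k]
    by (simp add: alternating_append_rev)
  then show ?thesis
    using w by (metis elt_closed elt_rev inv_closed inv_equality inv_inv)
qed

section \<open>Length\<close>

lemma len_le: "set u \<subseteq> {1..n} \<Longrightarrow> len (elt u) \<le> length u"
  using length_wrt_le[of "map s u" "s ` {1..n}" W "elt u"]
  by (auto simp: cox_length_def elt_def)

lemma reduced_word:
  assumes "w \<in> carrier W"
  obtains u where "set u \<subseteq> {1..n}" "elt u = w" "length u = len w"
proof -
  obtain v where v: "set v \<subseteq> {1..n}" "elt v = w" using carrier_elt[OF assms] .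
  obtain xs where xs: "set xs \<subseteq> s ` {1..n}" "list_prod W xs = w" "length xs = len w"
    using length_wrt_witness[of "map s v" "s ` {1..n}" W w] v
    unfolding cox_length_def elt_def by (metis image_mono set_map)
  have "xs \<in> map s ` lists {1..n}" using xs(1) by (auto simp flip: lists_image)
  then obtain u where "set u \<subseteq> {1..n}" "xs = map s u" by auto
  then show ?thesis using xs that[of u] by (simp add: elt_def)
qed

lemma even_length_cong:
  assumes "set u \<subseteq> {1..n}" "set v \<subseteq> {1..n}" "elt u = elt v"
  shows "even (length u) \<longleftrightarrow> even (length v)"
proof -
  have "even (length x) \<longleftrightarrow> even (length y)" if "cox_eq x y" for x y
    using that
  proof induction
    case (relator x y r)
    then have "even (length r)"
      by (auto simp: coxeter_relators_def length_concat sum_list_replicate)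
    then show ?case by simp
  qed auto
  from this[OF cox_eq_positive[OF assms]] show ?thesis by simp
qed

lemma even_len: "set u \<subseteq> {1..n} \<Longrightarrow> even (len (elt u)) \<longleftrightarrow> even (length u)"
  by (metis elt_closed even_length_cong reduced_word)

lemma even_len_s_mult:
  assumes "i \<in> {1..n}" "w \<in> carrier W"
  shows "even (len (s i \<star> w)) \<longleftrightarrow> odd (len w)"
proof -
  obtain u where u: "set u \<subseteq> {1..n}" "elt u = w" using carrier_elt assms(2) .
  then show ?thesis using even_len[of u] even_len[of "i # u"] assms by simp
qed

lemma len_one [simp]: "len \<one>\<^bsub>W\<^esub> = 0"
  using len_le[of "[]"] by simp

section \<open>Crossing walls\<close>

text \<open>Regard \<open>u\<close> as a gallery of chambers that starts at the identity and whose \<open>k\<close>-th step crosses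
  the wall of the reflection \<open>u\<^sub>1 \<cdots> u\<^sub>k \<cdots> u\<^sub>1\<close>.  The predicate says that the wall of \<open>t\<close> is crossed an
  odd number of times.  The recursion moves the base chamber of the gallery across its first wall.\<close>

primrec odd_crossing :: "nat list \<Rightarrow> letter list set \<Rightarrow> bool" where
  "odd_crossing [] t \<longleftrightarrow> False"
| "odd_crossing (i # u) t \<longleftrightarrow> (t = s i) \<noteq> odd_crossing u (s i \<star> t \<star> s i)"

lemma odd_crossing_append:
  "set u \<subseteq> {1..n} \<Longrightarrow> t \<in> carrier W \<Longrightarrow>
    odd_crossing (u @ v) t \<longleftrightarrow> odd_crossing u t \<noteq> odd_crossing v (inv\<^bsub>W\<^esub> elt u \<star> t \<star> elt u)"
proof (induction u arbitrary: t)
  case (Cons i u)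
  then have "inv\<^bsub>W\<^esub> elt (i # u) \<star> t \<star> elt (i # u) = inv\<^bsub>W\<^esub> elt u \<star> (s i \<star> t \<star> s i) \<star> elt u"
    by (simp add: inv_mult_group m_assoc)
  then show ?case using Cons by auto
qed simp

text \<open>Around a codimension-two face the gallery meets the walls of \<open>(s\<^sub>i s\<^sub>j)\<^sup>p s\<^sub>i\<close> one after the other.\<close>

lemma odd_crossing_alternating:
  assumes "t \<in> carrier W" "i \<in> {1..n}" "j \<in> {1..n}"
  shows "odd_crossing (alternating k i j) t \<longleftrightarrow>
    odd (card {p. p < k \<and> t = (s i \<star> s j) [^]\<^bsub>W\<^esub> p \<star> s i})"
  using assms
proof (induction k arbitrary: i j t)
  case (Suc k)
  define Q where "Q = {p. p < k \<and> s i \<star> t \<star> s i = (s j \<star> s i) [^]\<^bsub>W\<^esub> p \<star> s j}"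
  have shift: "(s i \<star> s j) [^]\<^bsub>W\<^esub> Suc p \<star> s i = s i \<star> ((s j \<star> s i) [^]\<^bsub>W\<^esub> p \<star> s j) \<star> s i" for p
  proof (induction p)
    case (Suc p)
    have "(s i \<star> s j) [^]\<^bsub>W\<^esub> Suc (Suc p) \<star> s i = (s i \<star> s j) \<star> ((s i \<star> s j) [^]\<^bsub>W\<^esub> Suc p \<star> s i)"
      using Suc.prems \<open>i \<in> {1..n}\<close> \<open>j \<in> {1..n}\<close> by (simp only: nat_pow_Suc2 m_assoc m_closed s_closed nat_pow_closed)
    also have "\<dots> = s i \<star> ((s j \<star> s i) [^]\<^bsub>W\<^esub> Suc p \<star> s j) \<star> s i"
      unfolding Suc using \<open>i \<in> {1..n}\<close> \<open>j \<in> {1..n}\<close>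
      by (simp only: nat_pow_Suc2 m_assoc m_closed s_closed nat_pow_closed)
    finally show ?case .
  qed (use \<open>i \<in> {1..n}\<close> \<open>j \<in> {1..n}\<close> in \<open>simp add: m_assoc\<close>)
  have conj: "t = s i \<star> x \<star> s i \<longleftrightarrow> s i \<star> t \<star> s i = x" if "x \<in> carrier W" for x
  proof -
    have "s i \<star> (s i \<star> y \<star> s i) \<star> s i = y" if "y \<in> carrier W" for y
      using Suc.prems that by (simp add: m_assoc)
    then show ?thesis using that Suc.prems by metis
  qed
  have "{p. p < Suc k \<and> t = (s i \<star> s j) [^]\<^bsub>W\<^esub> p \<star> s i}
      = (if t = s i then {0} else {}) \<union> Suc ` Q" (is "?L = ?R")
  proof -
    have "p \<in> ?L \<longleftrightarrow> p \<in> ?R" for p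
    proof (cases p)
      case 0
      then show ?thesis using Suc.prems by auto
    next
      case (Suc q)
      have "t = (s i \<star> s j) [^]\<^bsub>W\<^esub> Suc q \<star> s i \<longleftrightarrow> s i \<star> t \<star> s i = (s j \<star> s i) [^]\<^bsub>W\<^esub> q \<star> s j"
        unfolding shift using Suc.prems by (intro conj) auto
      then show ?thesis using Suc by (auto simp: Q_def simp del: nat_pow_Suc)
    qed
    then show ?thesis by blast
  qed
  moreover have "finite Q" by (simp add: Q_def)
  ultimately have "odd (card {p. p < Suc k \<and> t = (s i \<star> s j) [^]\<^bsub>W\<^esub> p \<star> s i})
      \<longleftrightarrow> (t = s i) \<noteq> odd (card Q)"
    by (auto simp: card_image)
  then show ?case using Suc.IH[of "s i \<star> t \<star> s i" j i] Suc.prems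
    by (simp add: alternating_Suc Q_def)
qed simp

lemma conj_s_conj_s: "i \<in> {1..n} \<Longrightarrow> x \<in> carrier W \<Longrightarrow> s i \<star> (s i \<star> x \<star> s i) \<star> s i = x"
  by (simp add: m_assoc)

lemma conj_s_eq_iff:
  assumes "i \<in> {1..n}" "x \<in> carrier W" "y \<in> carrier W"
  shows "s i \<star> x \<star> s i = y \<longleftrightarrow> x = s i \<star> y \<star> s i"
  using conj_s_conj_s[OF assms(1,2)] conj_s_conj_s[OF assms(1,3)] by metis

text \<open>The \<open>2k\<close> walls met by the word \<open>(s\<^sub>i s\<^sub>j)\<^sup>k\<close> repeat with period \<open>k\<close>, since \<open>(s\<^sub>i s\<^sub>j)\<^sup>k = 1\<close>; so each
  wall is met an even number of times.\<close>

lemma odd_crossing_relator: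
  assumes "i \<in> {1..n}" "j \<in> {1..n}" "m i j = enat k" "t \<in> carrier W"
  shows "\<not> odd_crossing (alternating (2 * k) i j) t"
proof -
  define A where "A = {p. p < k \<and> t = (s i \<star> s j) [^]\<^bsub>W\<^esub> p \<star> s i}"
  have shift: "(s i \<star> s j) [^]\<^bsub>W\<^esub> (p + k) = (s i \<star> s j) [^]\<^bsub>W\<^esub> p" for p
    using assms s_mult_pow_m[OF assms(1-3)] by (simp flip: nat_pow_mult)
  have "p \<in> (\<lambda>p. p + k) ` A" if "k \<le> p" "p < 2 * k" "t = (s i \<star> s j) [^]\<^bsub>W\<^esub> p \<star> s i" for p
    using that shift[of "p - k"] by (intro image_eqI[of _ _ "p - k"]) (auto simp: A_def)
  moreover have "p + k < 2 * k" "t = (s i \<star> s j) [^]\<^bsub>W\<^esub> (p + k) \<star> s i" if "p \<in> A" for p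
    using that shift[of p] by (auto simp: A_def)
  ultimately have "{p. p < 2 * k \<and> t = (s i \<star> s j) [^]\<^bsub>W\<^esub> p \<star> s i} = A \<union> (\<lambda>p. p + k) ` A"
    by (intro Set.set_eqI) (smt (verit) A_def Un_iff add_leD1 image_iff linorder_not_le mem_Collect_eq mult_2 trans_less_add1)
  moreover have "A \<inter> (\<lambda>p. p + k) ` A = {}" "finite A" by (auto simp: A_def)
  ultimately have "card {p. p < 2 * k \<and> t = (s i \<star> s j) [^]\<^bsub>W\<^esub> p \<star> s i} = card A + card A"
    by (simp add: card_Un_disjoint card_image)
  then show ?thesis using odd_crossing_alternating[OF assms(4,1,2), of "2 * k"] by simp
qed

text \<open>Inserting or deleting a relator or a cancelling pair changes every number of crossings by an even
  amount.  This is the reason for counting crossings only modulo two: the parity is a function of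
  the group element.\<close>

lemma odd_crossing_invariant:
  assumes "cox_eq x y" "t \<in> carrier W"
  shows "odd_crossing (map fst x) t \<longleftrightarrow> odd_crossing (map fst y) t"
  using assms
proof (induction arbitrary: t)
  case (cancel u v i e)
  have w: "set (map fst u) \<subseteq> {1..n}" "set (map fst v) \<subseteq> {1..n}" "i \<in> {1..n}"
    using cancel by (auto simp: words_def)
  let ?t = "inv\<^bsub>W\<^esub> elt (map fst u) \<star> t \<star> elt (map fst u)"
  have "?t \<in> carrier W" using w cancel.prems by simp
  then have "s i \<star> (s i \<star> ?t \<star> s i) \<star> s i = ?t" "s i \<star> ?t \<star> s i = s i \<longleftrightarrow> ?t = s i"
    using w(3) conj_s_conj_s conj_s_eq_iff[of i ?t "s i"] by simp_all
  then show ?case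
    using w cancel.prems by (auto simp: odd_crossing_append)
next
  case (relator u v r)
  have w: "set (map fst u) \<subseteq> {1..n}" "set (map fst v) \<subseteq> {1..n}" "set (map fst r) \<subseteq> {1..n}"
    using relator by (auto simp: words_def)
  obtain i j k where r: "map fst r = alternating (2 * k) i j"
    and ijk: "i \<in> {1..n}" "j \<in> {1..n}" "m i j = enat k"
    using relator.hyps by (auto simp: coxeter_relators_def alternating_eq_concat map_concat)
  let ?t = "inv\<^bsub>W\<^esub> elt (map fst u) \<star> t \<star> elt (map fst u)"
  have "?t \<in> carrier W" using w relator.prems by simp
  moreover from this have "\<not> odd_crossing (map fst r) ?t"
    unfolding r by (intro odd_crossing_relator ijk)
  moreover have "elt (map fst r) = \<one>\<^bsub>W\<^esub>"
    unfolding r using ijk by (simp add: elt_alternating s_mult_pow_m)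
  ultimately show ?case
    using w relator.prems by (simp add: odd_crossing_append)
qed auto

lemma odd_crossing_cong:
  assumes "set u \<subseteq> {1..n}" "set v \<subseteq> {1..n}" "elt u = elt v" "t \<in> carrier W"
  shows "odd_crossing u t \<longleftrightarrow> odd_crossing v t"
  using odd_crossing_invariant[OF cox_eq_positive[OF assms(1-3)] assms(4)] by (simp add: comp_def)

section \<open>The exchange condition\<close>

text \<open>If the gallery crosses the wall of \<open>t\<close> at its \<open>k\<close>-th step, reflecting the part after that step
  amounts to deleting the \<open>k\<close>-th letter.\<close>

lemma strong_exchange:
  assumes "set u \<subseteq> {1..n}" "t \<in> carrier W" "odd_crossing u t"
  shows "\<exists>v. set v \<subseteq> {1..n} \<and> Suc (length v) = length u \<and> t \<star> elt u = elt v"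
  using assms
proof (induction u arbitrary: t)
  case (Cons i u)
  then have i: "i \<in> {1..n}" and u: "set u \<subseteq> {1..n}" by auto
  show ?case
  proof (cases "t = s i")
    case True
    then show ?thesis using i u by (intro exI[of _ u]) auto
  next
    case False
    then obtain v where v: "set v \<subseteq> {1..n}" "Suc (length v) = length u"
      "s i \<star> t \<star> s i \<star> elt u = elt v"
      using Cons.IH[of "s i \<star> t \<star> s i"] Cons.prems i u by auto
    have "t \<star> elt (i # u) = s i \<star> (s i \<star> t \<star> s i \<star> elt u)"
      using Cons.prems i u by (simp add: m_assoc)
    then show ?thesis using v i by (intro exI[of _ "i # v"]) auto
  qed
qed simp

definition inversions :: "letter list set \<Rightarrow> letter list set set" where
  "inversions w = {t \<in> carrier W. \<exists>u. set u \<subseteq> {1..n} \<and> elt u = w \<and> odd_crossing u t}"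

lemma mem_inversions_elt:
  "set u \<subseteq> {1..n} \<Longrightarrow> t \<in> inversions (elt u) \<longleftrightarrow> t \<in> carrier W \<and> odd_crossing u t"
  using odd_crossing_cong by (auto simp: inversions_def)

lemma mem_inversions_mult:
  assumes "v \<in> carrier W" "w \<in> carrier W" "t \<in> carrier W"
  shows "t \<in> inversions (v \<star> w) \<longleftrightarrow> (t \<in> inversions v) \<noteq> (inv\<^bsub>W\<^esub> v \<star> t \<star> v \<in> inversions w)"
proof -
  obtain x y where "set x \<subseteq> {1..n}" "elt x = v" "set y \<subseteq> {1..n}" "elt y = w"
    using carrier_elt assms by metis
  then show ?thesis
    using assms mem_inversions_elt[of x t] mem_inversions_elt[of y "inv\<^bsub>W\<^esub> v \<star> t \<star> v"]
      mem_inversions_elt[of "x @ y" t] by (auto simp: odd_crossing_append)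
qed

lemma inversions_one: "inversions \<one>\<^bsub>W\<^esub> = {}"
  using mem_inversions_elt[of "[]"] by auto

lemma inversions_s: "i \<in> {1..n} \<Longrightarrow> inversions (s i) = {s i}"
  using mem_inversions_elt[of "[i]"] by auto

lemma mem_inversions_s_mult:
  assumes "i \<in> {1..n}" "w \<in> carrier W" "t \<in> carrier W"
  shows "t \<in> inversions (s i \<star> w) \<longleftrightarrow> (t = s i) \<noteq> (s i \<star> t \<star> s i \<in> inversions w)"
  using mem_inversions_mult[of "s i" w t] assms inversions_s[of i] by auto

lemma s_mem_inversions_s_mult:
  "i \<in> {1..n} \<Longrightarrow> w \<in> carrier W \<Longrightarrow> s i \<in> inversions (s i \<star> w) \<longleftrightarrow> s i \<notin> inversions w"
  using mem_inversions_s_mult[of i w "s i"] by simp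

lemma len_mult_inversion:
  assumes "w \<in> carrier W" "t \<in> inversions w"
  shows "len (t \<star> w) < len w"
proof -
  obtain u where u: "set u \<subseteq> {1..n}" "elt u = w" "length u = len w" using reduced_word assms(1) .
  then obtain v where "set v \<subseteq> {1..n}" "Suc (length v) = length u" "t \<star> elt u = elt v"
    using strong_exchange[of u t] assms mem_inversions_elt[of u t] by auto
  then show ?thesis using len_le[of v] u by simp
qed

text \<open>Of \<open>w\<close> and \<open>s\<^sub>i w\<close> exactly one lies beyond the wall of \<open>s\<^sub>i\<close>, and the exchange condition makes the
  length drop when that one is reflected back.\<close>

lemma len_s_mult:
  assumes "i \<in> {1..n}" "w \<in> carrier W"
  shows "len (s i \<star> w) = (if s i \<in> inversions w then len w - 1 else len w + 1)"
    and "s i \<in> inversions w \<Longrightarrow> len w > 0"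
proof -
  have up: "len (s i \<star> x) \<le> Suc (len x)" if x: "x \<in> carrier W" for x
  proof -
    obtain u where "set u \<subseteq> {1..n}" "elt u = x" "length u = len x" using reduced_word x .
    then show ?thesis using len_le[of "i # u"] assms by simp
  qed
  have down: "len x = Suc (len (s i \<star> x))" if "x \<in> carrier W" "s i \<in> inversions x" for x
    using up[of "s i \<star> x"] len_mult_inversion[of x "s i"] that assms by simp
  show "len (s i \<star> w) = (if s i \<in> inversions w then len w - 1 else len w + 1)"
    "s i \<in> inversions w \<Longrightarrow> len w > 0"
    using down[of w] down[of "s i \<star> w"] assms s_mem_inversions_s_mult[of i w] by auto
qed

lemma reduced_Cons:
  assumes "set (i # u) \<subseteq> {1..n}" "len (elt (i # u)) = length (i # u)"
  shows "len (elt u) = length u" "s i \<notin> inversions (elt u)" "s i \<in> inversions (elt (i # u))"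
  using assms len_s_mult[of i "elt u"] len_le[of u] s_mem_inversions_s_mult[of i "elt u"]
  by (auto split: if_splits)

text \<open>The letter that the exchange condition deletes cannot lie in \<open>u\<close>, as the wall of \<open>s\<^sub>i\<close> is not
  crossed (an odd number of times) there.\<close>

lemma exchange_in_suffix:
  assumes i: "i \<in> {1..n}" and u: "set u \<subseteq> {1..n}" and x: "set x \<subseteq> {1..n}"
    and "s i \<in> inversions (elt (u @ x))" "s i \<notin> inversions (elt u)"
  shows "\<exists>y. set y \<subseteq> {1..n} \<and> Suc (length y) = length x \<and> elt (u @ x) = elt (i # u @ y)"
proof -
  define t where "t = inv\<^bsub>W\<^esub> elt u \<star> s i \<star> elt u"
  have t: "t \<in> carrier W" using i u by (simp add: t_def)
  have "t \<in> inversions (elt x)"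
    using assms mem_inversions_mult[of "elt u" "elt x" "s i"] by (simp add: t_def)
  then obtain y where y: "set y \<subseteq> {1..n}" "Suc (length y) = length x" "t \<star> elt x = elt y"
    using strong_exchange[OF x t] mem_inversions_elt[OF x] by blast
  have canc: "elt u \<star> (inv\<^bsub>W\<^esub> elt u \<star> z) = z" if "z \<in> carrier W" for z
    using that u by (simp flip: m_assoc)
  have "elt (i # u @ y) = elt (u @ x)"
    using x y(1) y(3)[symmetric] u i by (simp add: t_def m_assoc canc)
  then show ?thesis using y by metis
qed

section \<open>Reflections\<close>

lemma reflections_subset: "reflections n m \<subseteq> carrier W"
  by (auto simp: reflections_def)

lemma conj_in_reflections:
  "g \<in> carrier W \<Longrightarrow> i \<in> {1..n} \<Longrightarrow> g \<star> s i \<star> inv\<^bsub>W\<^esub> g \<in> reflections n m"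
  unfolding reflections_def by (rule CollectI) blast

lemma reflection_square:
  assumes "t \<in> reflections n m" shows "t \<star> t = \<one>\<^bsub>W\<^esub>"
proof -
  obtain g i where "g \<in> carrier W" "i \<in> {1..n}" "t = g \<star> s i \<star> inv\<^bsub>W\<^esub> g"
    using assms by (auto simp: reflections_def)
  moreover have "inv\<^bsub>W\<^esub> g \<star> (g \<star> x) = x" if "g \<in> carrier W" "x \<in> carrier W" for g x
    using that by (simp flip: m_assoc)
  ultimately show ?thesis by (simp add: m_assoc)
qed

text \<open>Write \<open>t = g s\<^sub>i g\<inverse>\<close> and follow a gallery for \<open>g\<close>, then the step \<open>s\<^sub>i\<close>, then the first gallery
  backwards.  Its two outer parts are mirror images in the wall of \<open>t\<close> and together cross that wall
  an even number of times, while the middle step crosses it once.\<close>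

lemma reflection_mem_inversions_self:
  assumes "t \<in> reflections n m" shows "t \<in> inversions t"
proof -
  obtain g i where g: "g \<in> carrier W" "i \<in> {1..n}" "t = g \<star> s i \<star> inv\<^bsub>W\<^esub> g"
    using assms by (auto simp: reflections_def)
  have canc: "inv\<^bsub>W\<^esub> g \<star> (g \<star> x) = x" if "x \<in> carrier W" for x
    using that g by (simp flip: m_assoc)
  have t: "t \<in> carrier W" "inv\<^bsub>W\<^esub> g \<star> t \<star> g = s i" using g by (auto simp: m_assoc canc)
  have "t \<notin> inversions (g \<star> inv\<^bsub>W\<^esub> g)" using g by (simp add: inversions_one)
  then have "t \<in> inversions g \<longleftrightarrow> s i \<in> inversions (inv\<^bsub>W\<^esub> g)"
    using mem_inversions_mult[of g "inv\<^bsub>W\<^esub> g" t] g t by auto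
  moreover have "t \<in> inversions (g \<star> (s i \<star> inv\<^bsub>W\<^esub> g)) \<longleftrightarrow>
      (t \<in> inversions g) \<noteq> (s i \<in> inversions (s i \<star> inv\<^bsub>W\<^esub> g))"
    using mem_inversions_mult[of g "s i \<star> inv\<^bsub>W\<^esub> g" t] g t(1) unfolding t(2) by simp
  ultimately show ?thesis
    using s_mem_inversions_s_mult[of i "inv\<^bsub>W\<^esub> g"] g by (simp add: m_assoc)
qed

lemma mem_inversions_reflection_mult:
  assumes "t \<in> reflections n m" "w \<in> carrier W"
  shows "t \<in> inversions (t \<star> w) \<longleftrightarrow> t \<notin> inversions w"
proof -
  have t: "t \<in> carrier W" using assms(1) reflections_subset by blast
  then have "inv\<^bsub>W\<^esub> t \<star> t \<star> t = t" by simp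
  then show ?thesis
    using mem_inversions_mult[of t w t] reflection_mem_inversions_self[OF assms(1)] assms t by simp
qed

lemma conj_reflection:
  assumes "t \<in> reflections n m" "i \<in> {1..n}"
  shows "s i \<star> t \<star> s i \<in> reflections n m"
proof -
  obtain g j where g: "g \<in> carrier W" "j \<in> {1..n}" "t = g \<star> s j \<star> inv\<^bsub>W\<^esub> g"
    using assms by (auto simp: reflections_def)
  then have "s i \<star> t \<star> s i = (s i \<star> g) \<star> s j \<star> inv\<^bsub>W\<^esub> (s i \<star> g)"
    using assms by (simp add: inv_mult_group m_assoc)
  then show ?thesis using g assms conj_in_reflections[of "s i \<star> g" j] by simp
qed

lemma s_reflection: "i \<in> {1..n} \<Longrightarrow> s i \<in> reflections n m"
  using conj_in_reflections[of "\<one>\<^bsub>W\<^esub>" i] by simp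

text \<open>A reduced word crosses no wall twice: each further letter of a reduced word adds one new
  wall.\<close>

lemma inversions_card_subset:
  assumes "w \<in> carrier W"
  shows "inversions w \<subseteq> reflections n m \<and> finite (inversions w) \<and> card (inversions w) = len w"
proof -
  obtain u where "set u \<subseteq> {1..n}" "elt u = w" "length u = len w" using reduced_word assms .
  then show ?thesis
  proof (induction u arbitrary: w)
    case Nil
    then show ?case by (auto simp: inversions_one)
  next
    case (Cons i u)
    define x where "x = elt u"
    have i: "i \<in> {1..n}" and x: "x \<in> carrier W" "w = s i \<star> x" "set u \<subseteq> {1..n}"
      using Cons.prems by (auto simp: x_def)
    have "len x \<le> length u" using len_le[of u] x by (simp add: x_def)
    then have up: "s i \<notin> inversions x" "length u = len x"
      using Cons.prems(3) len_s_mult[OF i x(1)] x(2) by (auto split: if_splits)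
    have IH: "inversions x \<subseteq> reflections n m" "finite (inversions x)" "card (inversions x) = len x"
      using Cons.IH[of x] x up by (auto simp: x_def)
    have conj: "s i \<star> (s i \<star> t \<star> s i) \<star> s i = t" if "t \<in> carrier W" for t
      using that i by (simp add: m_assoc)
    have sub: "inversions y \<subseteq> carrier W" for y by (auto simp: inversions_def)
    have "inversions w = insert (s i) ((\<lambda>t. s i \<star> t \<star> s i) ` inversions x)" (is "_ = ?R")
    proof (rule Set.set_eqI)
      fix t
      have "t \<in> (\<lambda>t. s i \<star> t \<star> s i) ` inversions x \<longleftrightarrow> s i \<star> t \<star> s i \<in> inversions x"
        if t: "t \<in> carrier W"
      proof
        assume "t \<in> (\<lambda>t. s i \<star> t \<star> s i) ` inversions x"
        then obtain r where r: "r \<in> inversions x" "t = s i \<star> r \<star> s i" by blast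
        then show "s i \<star> t \<star> s i \<in> inversions x" using conj[of r] sub[of x] by auto
      next
        assume "s i \<star> t \<star> s i \<in> inversions x"
        then show "t \<in> (\<lambda>t. s i \<star> t \<star> s i) ` inversions x"
          using conj[OF t] by (intro image_eqI[of _ _ "s i \<star> t \<star> s i"]) simp_all
      qed
      moreover have "?R \<subseteq> carrier W" using i sub[of x] by auto
      moreover have "s i \<star> t \<star> s i \<notin> inversions x" if "t = s i" using i up(1) that by simp
      moreover have "t \<in> inversions w \<longleftrightarrow> (t = s i) \<noteq> (s i \<star> t \<star> s i \<in> inversions x)"
        if "t \<in> carrier W"
        using mem_inversions_s_mult[OF i x(1) that] x(2) by simp
      ultimately show "t \<in> inversions w \<longleftrightarrow> t \<in> ?R" using sub[of w] by blast
    qed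
    moreover have "s i \<notin> (\<lambda>t. s i \<star> t \<star> s i) ` inversions x"
    proof
      assume "s i \<in> (\<lambda>t. s i \<star> t \<star> s i) ` inversions x"
      then obtain t where t: "t \<in> inversions x" "s i = s i \<star> t \<star> s i" by auto
      then have "t = s i \<star> s i \<star> s i" using conj[of t] sub[of x] by auto
      then show False using t up i by simp
    qed
    moreover have "inj_on (\<lambda>t. s i \<star> t \<star> s i) (inversions x)"
      using conj sub[of x] by (intro inj_on_inverseI[of _ "\<lambda>t. s i \<star> t \<star> s i"]) auto
    ultimately show ?case
      using IH up Cons.prems conj_reflection[OF _ i] s_reflection[OF i] by (auto simp: card_image)
  qed
qed

section \<open>The longest element\<close>

text \<open>Any \<open>w\<^sub>0\<close> of maximal length has all generators as left descents.  By exchange, letters can then be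
  moved to the front of a word for \<open>w\<^sub>0\<close> one at a time, so that every reduced word is a prefix of a
  reduced word for \<open>w\<^sub>0\<close>.  For a reduced word of \<open>w\<close> this shows that \<open>w\<^sub>0\<close> is the only element of
  maximal length.  A reflection \<open>t\<close> that is no inversion of \<open>w\<^sub>0\<close> would make \<open>t w\<^sub>0\<close> longer than
  \<open>w\<^sub>0\<close>, so the inversions of \<open>w\<^sub>0\<close> are all the reflections.\<close>

lemma longest_element:
  assumes fin: "finite (carrier W)"
  obtains w0 where "w0 \<in> carrier W"
    and "\<And>w. w \<in> carrier W \<Longrightarrow> w \<noteq> w0 \<Longrightarrow> len w < len w0"
    and "card (reflections n m) = len w0"
proof -
  have "Max (len ` carrier W) \<in> len ` carrier W"
    using fin one_closed by (intro Max_in) blast+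
  then obtain w0 where "w0 \<in> carrier W" "Max (len ` carrier W) = len w0" by blast
  moreover from this have "len w \<le> len w0" if "w \<in> carrier W" for w
    using Max_ge[of "len ` carrier W" "len w"] fin that by simp
  ultimately have w0: "w0 \<in> carrier W" "\<And>w. w \<in> carrier W \<Longrightarrow> len w \<le> len w0" by blast+
  have desc: "s i \<in> inversions w0" if "i \<in> {1..n}" for i
    using len_s_mult(1)[OF that w0(1)] w0(2)[of "s i \<star> w0"] w0(1) that by (auto split: if_splits)
  have prefix: "\<exists>x. set x \<subseteq> {1..n} \<and> w0 = elt (u @ x) \<and> length u + length x = len w0"
    if "set u \<subseteq> {1..n}" "len (elt u) = length u" for u
    using that
  proof (induction u)
    case Nil
    then show ?case using reduced_word[OF w0(1)] by (metis append_Nil list.size(3) add_0)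
  next
    case (Cons i u)
    then have i: "i \<in> {1..n}" and u: "set u \<subseteq> {1..n}" by auto
    have lu: "len (elt u) = length u" "s i \<notin> inversions (elt u)"
      using reduced_Cons[OF Cons.prems] by blast+
    then obtain x where x: "set x \<subseteq> {1..n}" "w0 = elt (u @ x)" "length u + length x = len w0"
      using Cons.IH u by blast
    obtain y where y: "set y \<subseteq> {1..n}" "Suc (length y) = length x" "w0 = elt (i # u @ y)"
      using exchange_in_suffix[OF i u x(1)] desc[OF i] lu(2) x(2) by auto
    then show ?case using y x by (intro exI[of _ y]) auto
  qed
  have max: "len w < len w0" if w: "w \<in> carrier W" "w \<noteq> w0" for w
  proof -
    obtain u where u: "set u \<subseteq> {1..n}" "elt u = w" "length u = len w" using reduced_word w(1) .
    then obtain x where x: "set x \<subseteq> {1..n}" "w0 = elt (u @ x)" "length u + length x = len w0"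
      using prefix[of u] by auto
    then have "x \<noteq> []" using w u by auto
    then show ?thesis using x u by (cases x) auto
  qed
  have "t \<in> inversions w0" if t: "t \<in> reflections n m" for t
  proof -
    have tc: "t \<in> carrier W" using t reflections_subset by blast
    show ?thesis
    proof (rule ccontr)
      assume "t \<notin> inversions w0"
      then have "t \<in> inversions (t \<star> w0)"
        using mem_inversions_reflection_mult[OF t w0(1)] by simp
      then have "len (t \<star> (t \<star> w0)) < len (t \<star> w0)" using tc w0(1) by (intro len_mult_inversion) auto
      moreover have "t \<star> (t \<star> w0) = w0"
        using tc w0(1) reflection_square[OF t] by (simp flip: m_assoc)
      ultimately show False using w0(2)[of "t \<star> w0"] tc w0(1) by simp
    qed
  qed
  then have "inversions w0 = reflections n m" using inversions_card_subset[OF w0(1)] by blast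
  then have "card (reflections n m) = len w0" using inversions_card_subset[OF w0(1)] by simp
  then show ?thesis using that w0(1) max by blast
qed
end

section \<open>The numbers game\<close>

text \<open>Mozes's game: firing \<open>i\<close> changes the numbers \<open>f\<close> as the simple reflection \<open>s\<^sub>i\<close> changes the values of
  a linear functional on the simple roots.  This is the dual of the geometric representation for
  the bilinear form \<open>B\<close>; working in the dual avoids sums over a basis.\<close>

definition fire :: "(nat \<Rightarrow> nat \<Rightarrow> real) \<Rightarrow> nat \<Rightarrow> (nat \<Rightarrow> real) \<Rightarrow> nat \<Rightarrow> real" where
  "fire B i f = (\<lambda>l. f l - 2 * B i l * f i)"

lemma fire_fire: "B i i = 1 \<Longrightarrow> fire B i (fire B i f) = f"
  by (auto simp: fire_def fun_eq_iff)

lemma sin_add_eq: "sin (x + y) = sin (x - y) + 2 * cos x * sin y" for x y :: real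
  by (simp add: sin_add sin_diff)

text \<open>The plane of the two values \<open>f i\<close>, \<open>f j\<close> in polar coordinates: firing \<open>j\<close> is the reflection
  \<open>\<phi> \<mapsto> 2\<theta> - \<phi>\<close>, firing \<open>i\<close> is \<open>\<phi> \<mapsto> - \<phi>\<close>, and the composition is a rotation by \<open>- 2\<theta>\<close>.\<close>

lemma fire_fire_rotates:
  assumes B: "B i i = 1" "B j j = 1" "B i j = - cos \<theta>" "B j i = - cos \<theta>"
    and f: "f i = r * sin \<phi>" "f j = r * sin (\<theta> - \<phi>)"
  defines "g \<equiv> fire B i (fire B j f)"
  shows "g i = r * sin (\<phi> - 2 * \<theta>)" "g j = r * sin (\<theta> - (\<phi> - 2 * \<theta>))"
proof -
  have i: "fire B j f i = r * (sin \<phi> + 2 * cos \<theta> * sin (\<theta> - \<phi>))"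
    unfolding fire_def B f by algebra
  have "sin \<phi> + 2 * cos \<theta> * sin (\<theta> - \<phi>) = sin (2 * \<theta> - \<phi>)"
    using sin_add_eq[of \<theta> "\<theta> - \<phi>"] by simp
  with i have i: "fire B j f i = r * sin (2 * \<theta> - \<phi>)" by simp
  have "sin (\<phi> - 2 * \<theta>) = - sin (2 * \<theta> - \<phi>)" "sin (\<theta> - \<phi>) = - sin (\<phi> - \<theta>)"
    by (metis minus_diff_eq sin_minus)+
  moreover have j: "fire B j f j = - (r * sin (\<theta> - \<phi>))" by (simp add: fire_def B f)
  ultimately have j': "fire B j f j = r * sin (\<phi> - \<theta>)" by simp
  show "g i = r * sin (\<phi> - 2 * \<theta>)"
    using i \<open>sin (\<phi> - 2 * \<theta>) = - sin (2 * \<theta> - \<phi>)\<close> by (simp add: g_def fire_def[of B i] B)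
  have "g j = r * (sin (\<phi> - \<theta>) + 2 * cos \<theta> * sin (2 * \<theta> - \<phi>))"
    unfolding g_def fire_def[of B i] i j' B by algebra
  also have "sin (\<phi> - \<theta>) + 2 * cos \<theta> * sin (2 * \<theta> - \<phi>) = sin (\<theta> - (\<phi> - 2 * \<theta>))"
    using sin_add_eq[of \<theta> "2 * \<theta> - \<phi>"] by (simp add: algebra_simps)
  finally show "g j = r * sin (\<theta> - (\<phi> - 2 * \<theta>))" .
qed

lemma fire_fire_power:
  assumes B: "B i i = 1" "B j j = 1" "B i j = - cos \<theta>" "B j i = - cos \<theta>"
    and f: "f i = r * sin \<phi>" "f j = r * sin (\<theta> - \<phi>)"
  shows "((fire B i \<circ> fire B j) ^^ k) f i = r * sin (\<phi> - 2 * real k * \<theta>)"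
    and "((fire B i \<circ> fire B j) ^^ k) f j = r * sin (\<theta> - (\<phi> - 2 * real k * \<theta>))"
proof (induction k)
  case 0
  show "((fire B i \<circ> fire B j) ^^ 0) f i = r * sin (\<phi> - 2 * real 0 * \<theta>)"
    "((fire B i \<circ> fire B j) ^^ 0) f j = r * sin (\<theta> - (\<phi> - 2 * real 0 * \<theta>))"
    using f by simp_all
next
  case (Suc k)
  have \<phi>: "\<phi> - 2 * real k * \<theta> - 2 * \<theta> = \<phi> - 2 * real (Suc k) * \<theta>" by (simp add: algebra_simps)
  have "((fire B i \<circ> fire B j) ^^ Suc k) f = fire B i (fire B j (((fire B i \<circ> fire B j) ^^ k) f))"
    by simp
  then show "((fire B i \<circ> fire B j) ^^ Suc k) f i = r * sin (\<phi> - 2 * real (Suc k) * \<theta>)"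
    "((fire B i \<circ> fire B j) ^^ Suc k) f j = r * sin (\<theta> - (\<phi> - 2 * real (Suc k) * \<theta>))"
    using fire_fire_rotates[OF B Suc(1,2)] unfolding \<phi> by (simp_all only:)
qed

text \<open>Any other value \<open>f l\<close>, corrected by a suitable combination of \<open>f i\<close> and \<open>f j\<close>, is conserved; it is
  the value of \<open>f\<close> at a vector orthogonal to the plane of the two roots.\<close>

lemma fire_fire_conserves:
  assumes B: "B i i = 1" "B j j = 1" "B i j = - c" "B j i = - c"
    and ab: "\<alpha> - c * \<beta> = B i l" "\<beta> - c * \<alpha> = B j l"
  shows "((fire B i \<circ> fire B j) ^^ k) f l - \<alpha> * ((fire B i \<circ> fire B j) ^^ k) f i
      - \<beta> * ((fire B i \<circ> fire B j) ^^ k) f j = f l - \<alpha> * f i - \<beta> * f j"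
proof (induction k)
  case (Suc k)
  have "fire B i g l - \<alpha> * fire B i g i - \<beta> * fire B i g j = g l - \<alpha> * g i - \<beta> * g j" for g
    unfolding fire_def B ab[symmetric] by (simp add: algebra_simps)
  moreover have "fire B j g l - \<alpha> * fire B j g i - \<beta> * fire B j g j = g l - \<alpha> * g i - \<beta> * g j" for g
    unfolding fire_def B ab[symmetric] by (simp add: algebra_simps)
  ultimately show ?case using Suc by simp
qed simp

context
  fixes B :: "nat \<Rightarrow> nat \<Rightarrow> real" and i j M :: nat
  assumes B: "B i i = 1" "B j j = 1" "B i j = - cos (pi / M)" "B j i = - cos (pi / M)"
    and M: "2 \<le> M"
begin

lemma sin_pi_div_pos: "0 < sin (pi / M)"
  using M by (intro sin_gt_zero) (auto simp: field_simps)

text \<open>The two values \<open>f i\<close> and \<open>f j\<close> return after a full turn, and then so do all others by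
  the conservation law, which is available because \<open>cos\<^sup>2 (\<pi> / M) \<noteq> 1\<close>.\<close>

lemma fire_fire_power_id: "((fire B i \<circ> fire B j) ^^ M) f = f"
proof
  fix l
  define c where "c = cos (pi / M)"
  have ne: "1 - c * c \<noteq> 0"
    using sin_pi_div_pos sin_cos_squared_add[of "pi / M"] by (auto simp: c_def power2_eq_square)
  obtain r \<phi> where r: "(f j + cos (pi / M) * f i) / sin (pi / M) = r * cos \<phi>" "f i = r * sin \<phi>"
    using polar_Ex by blast
  have "f j = sin (pi / M) * (r * cos \<phi>) - cos (pi / M) * f i"
    using sin_pi_div_pos unfolding r(1)[symmetric] by simp
  then have "f j = r * sin (pi / M - \<phi>)" by (simp add: r(2) sin_diff algebra_simps)
  note power = fire_fire_power[of B i j, OF B r(2) this, of M]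
  have 2: "2 * real M * (pi / real M) = 2 * pi" using M by simp
  have "((fire B i \<circ> fire B j) ^^ M) f i = f i" "((fire B i \<circ> fire B j) ^^ M) f j = f j"
    using power r(2) \<open>f j = r * sin (pi / M - \<phi>)\<close> unfolding 2 by (simp_all add: sin_diff cos_diff)
  \<comment> \<open>The solution of the linear system for the conserved combination.\<close>
  moreover define \<alpha> where "\<alpha> = (B i l + c * B j l) / (1 - c * c)"
  moreover define \<beta> where "\<beta> = (B j l + c * B i l) / (1 - c * c)"
  have "\<alpha> * (1 - c * c) = B i l + c * B j l" "\<beta> * (1 - c * c) = B j l + c * B i l"
    using ne by (simp_all add: \<alpha>_def \<beta>_def)
  then have "(\<alpha> - c * \<beta>) * (1 - c * c) = B i l * (1 - c * c)"
    "(\<beta> - c * \<alpha>) * (1 - c * c) = B j l * (1 - c * c)"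
    by algebra+
  then have "\<alpha> - c * \<beta> = B i l" "\<beta> - c * \<alpha> = B j l"
    using ne by simp_all
  ultimately show "((fire B i \<circ> fire B j) ^^ M) f l = f l"
    using fire_fire_conserves[of B i j c \<alpha> \<beta> l M f] B by (simp add: c_def)
qed

lemma fire_fire_power_dvd:
  assumes "i \<noteq> j" and "(fire B i \<circ> fire B j) ^^ k = id"
  shows "M dvd k"
proof -
  \<comment> \<open>Polar coordinates \<open>r = 1\<close> and \<open>\<phi> = 0\<close>.\<close>
  define f :: "nat \<Rightarrow> real" where "f = (\<lambda>l. if l = j then sin (pi / M) else 0)"
  have "f i = 1 * sin 0" "f j = 1 * sin (pi / M - 0)" using assms(1) by (auto simp: f_def)
  from fire_fire_power[of B i j, OF B this, of k] assms
  have "sin (2 * real k * (pi / M)) = 0" "sin (pi / M) = sin (pi / M + 2 * real k * (pi / M))"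
    by (auto simp: f_def)
  then have "cos (2 * real k * (pi / M)) = 1"
    using sin_pi_div_pos by (simp add: sin_add)
  then obtain l :: int where "2 * real k * (pi / M) = real_of_int l * 2 * pi"
    using cos_one_2pi_int by blast
  then have "real k = real_of_int l * real M" using M by (simp add: field_simps)
  then have "int k = l * int M" by (metis of_int_eq_iff of_int_mult of_int_of_nat_eq)
  then show ?thesis by (metis dvd_triv_right int_dvd_int_iff)
qed

end

lemma foldr_concat_replicate: "foldr f (concat (replicate k [a, b])) = (f a \<circ> f b) ^^ k"
  by (induction k) auto

lemma map_concat_replicate: "map f (concat (replicate k [a, b])) = concat (replicate k [f a, f b])"
  by (induction k) auto

context coxeter
begin

text \<open>An infinite entry of the matrix imposes no relation, so it may be replaced by any \<open>N \<ge> 2\<close> in the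
  numbers game.\<close>

lemma order_s_mult_s_dvd:
  assumes i: "i \<in> {1..n}" and j: "j \<in> {1..n}" "i \<noteq> j"
    and 1: "(s i \<star> s j) [^]\<^bsub>W\<^esub> k = \<one>\<^bsub>W\<^esub>" and N: "2 \<le> N"
  shows "(case m i j of enat d \<Rightarrow> d | \<infinity> \<Rightarrow> N) dvd k"
proof -
  define M where "M a b = (case m a b of enat d \<Rightarrow> d | \<infinity> \<Rightarrow> N)" for a b
  define B :: "nat \<Rightarrow> nat \<Rightarrow> real" where "B a b = - cos (pi / M a b)" for a b
  have M1: "M a a = 1" if "a \<in> {1..n}" for a
    using m_diag[OF that] by (simp add: M_def one_enat_def)
  have M2: "2 \<le> M a b" "M b a = M a b" if "a \<in> {1..n}" "b \<in> {1..n}" "a \<noteq> b" for a b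
    using m_ge_2[OF that] m_sym[OF that(1,2)] N by (auto simp: M_def split: enat.split)
  have B1: "B a a = 1" if "a \<in> {1..n}" for a using M1[OF that] by (simp add: B_def)
  define act where "act l = fire B (fst l)" for l :: letter
  have "foldr act r f = f" if r: "r \<in> coxeter_relators n m" for r f
  proof -
    obtain a b d where r: "r = concat (replicate d [(a, True), (b, True)])"
      "a \<in> {1..n}" "b \<in> {1..n}" "m a b = enat d"
      using r by (auto simp: coxeter_relators_def)
    have "foldr act r f = ((fire B a \<circ> fire B b) ^^ d) f"
      by (simp add: r foldr_concat_replicate act_def)
    also have "\<dots> = f"
    proof (cases "a = b")
      case True
      then have "d = 1" using r m_diag[of a] by (simp add: one_enat_def)
      then show ?thesis using True r fire_fire[of B a] B1 by (simp add: One_nat_def)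
    next
      case False
      have "M a b = d" using r by (simp add: M_def)
      then show ?thesis
        using fire_fire_power_id[of B a b "M a b" f] B1 r M2[OF r(2,3) False] by (simp add: B_def)
    qed
    finally show ?thesis .
  qed
  moreover have "cox_eq (map (\<lambda>i. (i, True)) (alternating (2 * k) i j)) (map (\<lambda>i. (i, True)) [])"
    using set_alternating[of "2 * k" i j] i j 1 by (intro cox_eq_positive) (auto simp: elt_alternating)
  ultimately have "foldr act (map (\<lambda>i. (i, True)) (alternating (2 * k) i j)) = foldr act []"
    using fire_fire[of B] B1
    by (intro word_eq_action[of "{1..n}" "coxeter_relators n m"]) (auto simp: act_def)
  then have "(fire B i \<circ> fire B j) ^^ k = id"
    by (simp add: alternating_eq_concat map_concat_replicate foldr_concat_replicate act_def id_def)
  then have "M i j dvd k"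
    using fire_fire_power_dvd[of B i j "M i j" k] B1 i j M2[OF i j] by (simp add: B_def)
  then show ?thesis by (simp add: M_def)
qed

text \<open>The order of \<open>s\<^sub>i s\<^sub>j\<close> is at least \<open>m i j\<close>; for an infinite entry choose \<open>N > k\<close> in the previous
  lemma.\<close>

lemma order_s_mult_s:
  assumes "i \<in> {1..n}" "j \<in> {1..n}" "i \<noteq> j" "(s i \<star> s j) [^]\<^bsub>W\<^esub> k = \<one>\<^bsub>W\<^esub>" "k > 0"
  shows "m i j \<le> enat k"
proof (cases "m i j")
  case (enat d)
  then show ?thesis using order_s_mult_s_dvd[OF assms(1-4), of 2] assms(5) by (auto dest: dvd_imp_le)
next
  case infinity
  then show ?thesis using order_s_mult_s_dvd[OF assms(1-4), of "k + 2"] assms(5) by (auto dest: dvd_imp_le)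
qed

section \<open>Matsumoto's theorem\<close>

definition braid_move :: "nat list \<Rightarrow> nat list \<Rightarrow> bool" where
  "braid_move u v \<longleftrightarrow> (\<exists>a b i j k. i \<in> {1..n} \<and> j \<in> {1..n} \<and> i \<noteq> j \<and> m i j = enat k \<and>
    u = a @ alternating k i j @ b \<and> v = a @ alternating k j i @ b)"

lemma braid_moves_Cons: "braid_move\<^sup>*\<^sup>* u v \<Longrightarrow> braid_move\<^sup>*\<^sup>* (i # u) (i # v)"
proof (induction rule: rtranclp_induct)
  case (step v w)
  have "braid_move (i # v) (i # w)"
    using step(2) unfolding braid_move_def by (metis append_Cons)
  with step(3) show ?case by (rule rtranclp.rtrancl_into_rtrancl)
qed simp

lemma s_notin_inversions_alternating:
  assumes ij: "i \<in> {1..n}" "j \<in> {1..n}" "i \<noteq> j" and k: "enat k < m i j"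
  shows "s i \<notin> inversions (elt (alternating k j i))"
proof -
  have w: "set (alternating k j i) \<subseteq> {1..n}" using set_alternating[of k j i] ij by auto
  have "s i \<noteq> (s j \<star> s i) [^]\<^bsub>W\<^esub> p \<star> s j" if p: "p < k" for p
  proof
    assume eq: "s i = (s j \<star> s i) [^]\<^bsub>W\<^esub> p \<star> s j"
    have "(s j \<star> s i) [^]\<^bsub>W\<^esub> Suc p = ((s j \<star> s i) [^]\<^bsub>W\<^esub> p \<star> s j) \<star> s i"
      using ij by (simp add: m_assoc)
    also have "\<dots> = \<one>\<^bsub>W\<^esub>" using eq ij(1) by (metis s_square)
    finally have "m i j \<le> enat (Suc p)"
      using order_s_mult_s[of j i "Suc p"] ij m_sym[of i j] by simp
    then show False using k p by (metis enat_ord_simps(1) leD less_le_trans Suc_leI)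
  qed
  then have none: "{p. p < k \<and> s i = (s j \<star> s i) [^]\<^bsub>W\<^esub> p \<star> s j} = {}" by blast
  show ?thesis
    using odd_crossing_alternating[of "s i" j i k] ij mem_inversions_elt[OF w, of "s i"]
    unfolding none by simp
qed

text \<open>Take a reduced word of \<open>w\<close> that starts with an alternating word of length \<open>k\<close> with first letter
  \<open>j\<close>, and exchange the descent \<open>i\<close> into it.  The deleted letter comes after the alternating part,
  because \<open>s\<^sub>i\<close> is no inversion of that part while \<open>k < m i j\<close>.\<close>

lemma two_descents:
  assumes w: "w \<in> carrier W"
    and "i \<in> {1..n}" "j \<in> {1..n}" "i \<noteq> j" "s i \<in> inversions w" "s j \<in> inversions w"
    and "enat k \<le> m i j"
  shows "\<exists>x. set x \<subseteq> {1..n} \<and> w = elt (alternating k i j @ x) \<and> k + length x = len w"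
  using assms(2-)
proof (induction k arbitrary: i j)
  case 0
  then show ?case using reduced_word[OF w] by (metis alternating_0 append_Nil add_0)
next
  case (Suc k)
  then have "enat k < m i j" "enat k \<le> m j i"
    using m_sym[of i j] by (auto simp: Suc_ile_eq)
  then obtain x where x: "set x \<subseteq> {1..n}" "w = elt (alternating k j i @ x)" "k + length x = len w"
    using Suc.IH[of j i] Suc.prems by auto
  have "set (alternating k j i) \<subseteq> {1..n}" using set_alternating[of k j i] Suc.prems by auto
  then obtain y where "set y \<subseteq> {1..n}" "Suc (length y) = length x"
      "w = elt (i # alternating k j i @ y)"
    using exchange_in_suffix[of i "alternating k j i" x] Suc.prems x
      s_notin_inversions_alternating[OF Suc.prems(1-3) \<open>enat k < m i j\<close>] by auto
  then show ?case using x by (intro exI[of _ y]) (auto simp: alternating_Suc)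
qed

text \<open>Induction on the length.  Words with the same first letter are treated by the induction
  hypothesis.  If the first letters are \<open>i \<noteq> j\<close>, both are descents, and \<open>w\<close> has a reduced
  word that starts with the alternating word of length \<open>m i j\<close>.  Then \<open>u\<close> is connected with the
  version that starts with \<open>i\<close>, \<open>v\<close> with the one that starts with \<open>j\<close>, and these differ by one
  braid move.\<close>

theorem matsumoto:
  assumes "set u \<subseteq> {1..n}" "set v \<subseteq> {1..n}" "elt u = elt v"
    and "length u = len (elt u)" "length v = len (elt u)"
  shows "braid_move\<^sup>*\<^sup>* u v"
  using assms
proof (induction "length u" arbitrary: u v rule: less_induct)
  case less
  show ?case
  proof (cases u)
    case Nil
    then show ?thesis using less.prems by simp
  next
    case (Cons i u')
    then obtain j v' where v: "v = j # v'" using less.prems by (cases v) auto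
    have i: "i \<in> {1..n}" and j: "j \<in> {1..n}" using less.prems Cons v by auto
    have same: "braid_move\<^sup>*\<^sup>* (l # x) (l # y)"
      if "set (l # x) \<subseteq> {1..n}" "set (l # y) \<subseteq> {1..n}" "elt (l # x) = elt u" "elt (l # y) = elt u"
        "length (l # x) = len (elt u)" "length (l # y) = len (elt u)" for l x y
    proof -
      have "s l \<star> elt x = s l \<star> elt y" using that by simp
      then have "elt x = elt y" using that(1,2) by simp
      moreover have "len (elt x) = length x" "len (elt y) = length y"
        using reduced_Cons[of l x] reduced_Cons[of l y] that by auto
      moreover have "length x < length u" "set x \<subseteq> {1..n}" "set y \<subseteq> {1..n}"
        using that less.prems(4) by simp_all
      ultimately show ?thesis by (intro braid_moves_Cons less.hyps) simp_all
    qed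
    show ?thesis
    proof (cases "i = j")
      case True
      then show ?thesis using same[of i u' v'] less.prems Cons v by auto
    next
      case False
      let ?w = "elt u"
      have w: "?w \<in> carrier W" using less.prems by simp
      have desc: "s i \<in> inversions ?w" "s j \<in> inversions ?w"
        using reduced_Cons(3)[of i u'] reduced_Cons(3)[of j v'] less.prems Cons v by auto
      note two = two_descents[OF w i j False desc]
      show ?thesis
      proof (cases "m i j")
        case infinity
        then show ?thesis using two[of "Suc (len ?w)"] by auto
      next
        case (enat d)
        then have "d \<noteq> 0" using m_ge_2[OF i j False] by auto
        then obtain e where e: "d = Suc e" by (cases d) auto
        obtain x where x: "set x \<subseteq> {1..n}" "?w = elt (alternating d i j @ x)" "d + length x = len ?w"
          using two[of d] enat by auto
        have a: "set (alternating d i j) \<subseteq> {1..n}" "set (alternating d j i) \<subseteq> {1..n}"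
          using set_alternating[of d i j] set_alternating[of d j i] i j by auto
        then have x': "?w = elt (alternating d j i @ x)"
          using x elt_braid[OF i j enat] by simp
        have alt: "alternating d i j @ x = i # alternating e j i @ x"
          "alternating d j i @ x = j # alternating e i j @ x"
          by (simp_all add: e alternating_Suc)
        have set: "set (alternating d i j @ x) \<subseteq> {1..n}" "set (alternating d j i @ x) \<subseteq> {1..n}"
          using a x(1) by simp_all
        have "braid_move\<^sup>*\<^sup>* u (alternating d i j @ x)"
          unfolding Cons alt
          by (rule same) (use less.prems(1,4) set(1) x(2,3) in \<open>simp_all only: Cons[symmetric] alt[symmetric] length_append length_alternating\<close>)
        also have "braid_move (alternating d i j @ x) (alternating d j i @ x)"
          unfolding braid_move_def using i j False enat by (metis append_Nil)
        also have "braid_move\<^sup>*\<^sup>* (alternating d j i @ x) v"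
          unfolding v alt
          by (rule same) (use less.prems(2,3,5) set(2) x(3) x' in \<open>simp_all only: v[symmetric] alt[symmetric] length_append length_alternating\<close>)
        finally show ?thesis .
      qed
    qed
  qed
qed

section \<open>Words without braid moves\<close>

lemma rigid_word_unique:
  assumes "braid_move\<^sup>*\<^sup>* u v" "\<And>x. \<not> braid_move u x"
  shows "u = v"
  using assms by (metis converse_rtranclpE)

text \<open>A prefix that is reduced and admits no braid move is the only reduced word of its element.  Hence
  its last letter is the only right descent of that element, and the next letter, being different,
  increases the length.\<close>

lemma rigid_sequence_infinite:
  fixes c :: "nat \<Rightarrow> nat"
  assumes c: "\<And>t. c t \<in> {1..n}" "\<And>t. c (Suc t) \<noteq> c t"
    and rigid: "\<And>k x. \<not> braid_move (map c [0..<k]) x"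
  shows "infinite (carrier W)"
proof -
  have c_sub: "set (map c [0..<k]) \<subseteq> {1..n}" for k using c(1) by auto
  have len: "len (elt (map c [0..<k])) = k" for k
  proof (induction k)
    case (Suc k)
    let ?u = "map c [0..<k]"
    define x where "x = elt ?u \<star> s (c k)"
    have x: "x \<in> carrier W" "elt (map c [0..<Suc k]) = x"
      using c(1)[of k] c_sub[of k] by (auto simp: x_def)
    then have "len x \<le> Suc k" "even (len x) \<longleftrightarrow> even (Suc k)"
      using len_le[OF c_sub[of "Suc k"]] even_len[OF c_sub[of "Suc k"]] by auto
    moreover have "\<not> Suc (len x) \<le> k"
    proof
      assume le: "Suc (len x) \<le> k"
      obtain v where v: "set v \<subseteq> {1..n}" "elt v = x" "length v = len x" using reduced_word x(1) .
      \<comment> \<open>If the next letter shortens, it ends another reduced word of the same element.\<close>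
      have "elt (v @ [c k]) = elt ?u"
        using v c(1)[of k] c_sub[of k] by (simp add: x_def m_assoc)
      moreover from this have "length (v @ [c k]) = k"
        using len_le[of "v @ [c k]"] v c(1)[of k] le Suc.IH by auto
      ultimately have "braid_move\<^sup>*\<^sup>* ?u (v @ [c k])"
        using v c(1)[of k] c_sub[of k] Suc.IH by (intro matsumoto) auto
      then have "?u = v @ [c k]" using rigid by (rule rigid_word_unique)
      then have "k \<noteq> 0" "last ?u = c k" by (cases k; simp)+
      then have "c (k - 1) = c k" by (simp add: last_map)
      then show False using c(2)[of "k - 1"] \<open>k \<noteq> 0\<close> by simp
    qed
    ultimately have "len x = Suc k" by (cases "len x = k") auto
    then show ?case using x by simp
  qed simp
  then have "inj (\<lambda>k. elt (map c [0..<k]))" by (intro inj_on_inverseI[of _ len])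
  moreover have "range (\<lambda>k. elt (map c [0..<k])) \<subseteq> carrier W" using c_sub by auto
  ultimately show ?thesis using finite_subset finite_imageD infinite_UNIV_nat by blast
qed

lemma braid_move_nth:
  assumes "braid_move u v"
  obtains p k where "p + k \<le> length u" "2 \<le> k" "u ! p \<in> {1..n}" "u ! Suc p \<in> {1..n}"
    "u ! p \<noteq> u ! Suc p" "m (u ! p) (u ! Suc p) = enat k" "3 \<le> k \<Longrightarrow> u ! (p + 2) = u ! p"
proof -
  obtain a b i j k where ij: "i \<in> {1..n}" "j \<in> {1..n}" "i \<noteq> j" "m i j = enat k"
    and u: "u = a @ alternating k i j @ b"
    using assms unfolding braid_move_def by blast
  have k: "2 \<le> k" using m_ge_2[OF ij(1-3)] ij(4) by simp
  have nth: "u ! (length a + q) = (if even q then i else j)" if "q < k" for q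
    using that by (simp add: u nth_append alternating_def)
  have "u ! length a = i" "u ! Suc (length a) = j" "3 \<le> k \<Longrightarrow> u ! (length a + 2) = i"
    using nth[of 0] nth[of 1] nth[of 2] k by (auto simp: One_nat_def)
  then show ?thesis using that[of "length a" k] ij k by (auto simp: u)
qed

text \<open>If no two generators commute, the sequence \<open>1, 2, 3, 1, 2, 3, \<dots>\<close> admits no braid move, since such
  a move needs two equal letters at distance two.\<close>

lemma finite_commuting_pair:
  assumes fin: "finite (carrier W)" and n: "3 \<le> n"
  shows "\<exists>i\<in>{1..n}. \<exists>j\<in>{1..n}. i \<noteq> j \<and> m i j = 2"
proof (rule ccontr)
  assume none: "\<not> ?thesis"
  define c :: "nat \<Rightarrow> nat" where "c t = t mod 3 + 1" for t
  have "\<not> braid_move (map c [0..<l]) x" for l x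
  proof
    assume "braid_move (map c [0..<l]) x"
    then obtain p k where p: "p + k \<le> l" "2 \<le> k" "c p \<in> {1..n}" "c (Suc p) \<in> {1..n}"
      "c p \<noteq> c (Suc p)" "m (c p) (c (Suc p)) = enat k" "3 \<le> k \<Longrightarrow> c (p + 2) = c p"
      by (rule braid_move_nth) auto
    have "k \<noteq> 2"
    proof
      assume "k = 2"
      then have "m (c p) (c (Suc p)) = 2" using p by (simp add: numeral_eq_enat)
      then show False using none p(3-5) by blast
    qed
    then have "c (p + 2) = c p" using p by simp
    then show False unfolding c_def by presburger
  qed
  moreover have "c t \<in> {1..n}" for t
    using n mod_less_divisor[of 3 t] by (simp add: c_def)
  moreover have "c (Suc t) \<noteq> c t" for t
    unfolding c_def by presburger
  ultimately show False using rigid_sequence_infinite[of c] fin by blast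
qed

lemma finite_rank_2:
  assumes fin: "finite (carrier W)" and n: "n = 2"
  shows "m 1 2 \<noteq> \<infinity>"
proof
  assume inf: "m 1 2 = \<infinity>"
  define c :: "nat \<Rightarrow> nat" where "c t = t mod 2 + 1" for t
  have "m i j = \<infinity>" if "i \<in> {1..n}" "j \<in> {1..n}" "i \<noteq> j" for i j
  proof -
    have "i = 1 \<and> j = 2 \<or> i = 2 \<and> j = 1" using that n by auto
    then show ?thesis using inf m_sym[OF that(1,2)] by auto
  qed
  then have "\<not> braid_move u v" for u v unfolding braid_move_def by auto
  moreover have "c t \<in> {1..n}" for t using n by (simp add: c_def)
  moreover have "c (Suc t) \<noteq> c t" for t unfolding c_def by presburger
  ultimately show False using rigid_sequence_infinite[of c] fin by blast
qed

text \<open>This is where the excluded types enter: a finite Coxeter group of rank at least two that is not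
  dihedral of odd type has two generators whose product has even order.\<close>

lemma even_pair:
  assumes "finite (carrier W)" "2 \<le> n" "\<And>k. odd k \<Longrightarrow> 3 \<le> k \<Longrightarrow> \<not> type_I2 k n m"
  obtains i j d where "i \<in> {1..n}" "j \<in> {1..n}" "i \<noteq> j" "m i j = enat d" "even d"
proof (cases "n = 2")
  case True
  then obtain d where d: "m 1 2 = enat d" using finite_rank_2 assms(1) by auto
  then have "2 \<le> d" using m_ge_2[of 1 2] True by simp
  then have "even d" using assms(3)[of d] d True coxeter_matrix
    by (cases "d = 2") (auto simp: type_I2_def)
  then show ?thesis using that[of 1 2 d] d True by simp
next
  case False
  then obtain i j where "i \<in> {1..n}" "j \<in> {1..n}" "i \<noteq> j" "m i j = 2"
    using finite_commuting_pair assms by auto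
  then show ?thesis using that[of i j 2] by (simp add: numeral_eq_enat)
qed

section \<open>The lift to the braid group\<close>

abbreviation "braid_class u \<equiv> word_rel {1..n} (braid_relators n m) `` {u}"

lemma braid_eq_imp_cox_eq:
  assumes "word_eq {1..n} (braid_relators n m) u v" shows "cox_eq u v"
proof (rule word_eq_change_relators[OF assms])
  fix r assume r: "r \<in> braid_relators n m" "r \<in> words {1..n}"
  then obtain i j k where ij: "i \<in> {1..n}" "j \<in> {1..n}" "m i j = enat k"
    and "r = alt_word k i j @ inv_word (alt_word k j i)"
    by (auto simp: braid_relators_def)
  then have "map fst r = alternating k i j @ rev (alternating k j i)"
    by (auto simp: alt_word_def inv_word_def alternating_def rev_map case_prod_beta comp_def)
  then show "cox_eq r []"
    using r ij by (subst cox_eq_iff)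
      (auto simp: alternating_append_rev elt_alternating s_mult_pow_m words_def)
qed

text \<open>The braid relator \<open>x y\<inverse>\<close> for the alternating words \<open>x\<close>, \<open>y\<close> makes both equal to \<open>x y\<inverse> y\<close>.\<close>

lemma braid_move_class:
  assumes "set u \<subseteq> {1..n}" "braid_move u v"
  shows "word_eq {1..n} (braid_relators n m) (map (\<lambda>i. (i, True)) u) (map (\<lambda>i. (i, True)) v)"
proof -
  let ?R = "braid_relators n m"
  obtain a b i j k where ij: "i \<in> {1..n}" "j \<in> {1..n}" "i \<noteq> j" "m i j = enat k"
    and u: "u = a @ alternating k i j @ b" "v = a @ alternating k j i @ b"
    using assms unfolding braid_move_def by blast
  have alt: "map (\<lambda>i. (i, True)) (alternating k x y) = alt_word k x y" for x y
    by (simp add: alternating_def alt_word_def)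
  let ?x = "alt_word k i j" and ?y = "alt_word k j i"
  have w: "?x \<in> words {1..n}" "?y \<in> words {1..n}" "inv_word ?y \<in> words {1..n}" "[] \<in> words {1..n}"
    using ij by (auto simp: words_def alt_word_def inv_word_def)
  then have xy: "?x @ inv_word ?y \<in> words {1..n}" by (simp add: words_def)
  have "?x @ inv_word ?y \<in> ?R" using ij unfolding braid_relators_def by blast
  then have "word_eq {1..n} ?R ([] @ (?x @ inv_word ?y) @ ?y) ([] @ ?y)"
    by (intro word_eq.relator w xy)
  moreover have "word_eq {1..n} ?R (?x @ (inv_word ?y @ ?y) @ []) (?x @ [] @ [])"
    by (intro word_eq_context word_eq_inv_word w)
  ultimately have "word_eq {1..n} ?R ?x ?y"
    by simp (blast intro: word_eq.sym word_eq.trans)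
  then show ?thesis
    using assms(1) unfolding u map_append alt
    by (intro word_eq_context) (auto simp: words_def)
qed

lemma list_prod_braid_gen:
  assumes "set u \<subseteq> {1..n}"
  shows "list_prod (braid_group n m) (map (braid_gen n m) u) = braid_class (map (\<lambda>i. (i, True)) u)"
proof -
  have "map (\<lambda>i. (i, True)) u \<in> words {1..n}" using assms by (auto simp: words_def)
  moreover have "braid_gen n m = (\<lambda>i. braid_class [(i, True)])"
    by (simp add: fun_eq_iff braid_gen_def generator_def)
  ultimately show ?thesis
    using list_prod_letter_classes[of "map (\<lambda>i. (i, True)) u" "{1..n}" "braid_relators n m"]
    by (simp add: braid_group_def comp_def)
qed

lemma braid_moves_class:
  assumes "braid_move\<^sup>*\<^sup>* u v" "set u \<subseteq> {1..n}"
  shows "set v \<subseteq> {1..n} \<and>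
    braid_class (map (\<lambda>i. (i, True)) u) = braid_class (map (\<lambda>i. (i, True)) v)"
  using assms
proof (induction rule: rtranclp_induct)
  case (step v w)
  then have v: "set v \<subseteq> {1..n}" by simp
  moreover have "set w = set v"
  proof -
    obtain a b i j k where "i \<in> {1..n}" "j \<in> {1..n}" "i \<noteq> j" "m i j = enat k"
      and u: "v = a @ alternating k i j @ b" "w = a @ alternating k j i @ b"
      using step(2) unfolding braid_move_def by blast
    then have "2 \<le> k" using m_ge_2[of i j] by simp
    then have "set (alternating k x y) = {x, y}" for x y :: nat
      by (cases k rule: nat.exhaust, simp, rename_tac l, case_tac l)
        (use set_alternating[of k x y] in \<open>auto simp: alternating_Suc\<close>)
    then show ?thesis using u by auto
  qed
  moreover have "braid_class (map (\<lambda>i. (i, True)) v) = braid_class (map (\<lambda>i. (i, True)) w)"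
    using braid_move_class[OF v step(2)] word_eq_words by (subst word_class_eq_iff) auto
  ultimately show ?case using step by simp
qed simp

lemma braid_lift_eq:
  assumes u: "set u \<subseteq> {1..n}" "length u = len (elt u)"
  shows "braid_lift n m (elt u) = braid_class (map (\<lambda>i. (i, True)) u)"
  unfolding braid_lift_def
proof (rule the_equality)
  show "\<exists>is. reduced_expr n m is (elt u) \<and> braid_class (map (\<lambda>i. (i, True)) u)
      = list_prod (braid_group n m) (map (braid_gen n m) is)"
    using u list_prod_braid_gen[OF u(1)] by (intro exI[of _ u]) (auto simp: reduced_expr_def elt_def)
next
  fix b assume "\<exists>is. reduced_expr n m is (elt u) \<and> b = list_prod (braid_group n m) (map (braid_gen n m) is)"
  then obtain v where v: "set v \<subseteq> {1..n}" "elt v = elt u" "length v = len (elt u)"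
    "b = list_prod (braid_group n m) (map (braid_gen n m) v)"
    by (auto simp: reduced_expr_def elt_def)
  then have "braid_move\<^sup>*\<^sup>* u v" using u by (intro matsumoto) auto
  then show "b = braid_class (map (\<lambda>i. (i, True)) u)"
    using braid_moves_class u(1) v list_prod_braid_gen[OF v(1)] by simp
qed

text \<open>A word in the braid generators and their inverses turns into a word in the Coxeter generators of
  the same number of letters, so the lift cannot be written with fewer letters than \<open>w\<close>.\<close>

lemma braid_length_lift:
  assumes "w \<in> carrier W"
  shows "braid_length n m (braid_lift n m w) = len w"
proof -
  obtain u where u: "set u \<subseteq> {1..n}" "elt u = w" "length u = len w" using reduced_word assms .
  let ?pu = "map (\<lambda>i. (i, True)) u"
  let ?B = "braid_group n m"
  let ?S = "braid_gen n m ` {1..n} \<union> (\<lambda>i. inv\<^bsub>?B\<^esub> braid_gen n m i) ` {1..n}"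
  have lift: "braid_lift n m w = braid_class ?pu" using braid_lift_eq[of u] u by simp
  have prod: "list_prod ?B (map (braid_gen n m) u) = braid_class ?pu"
    by (rule list_prod_braid_gen[OF u(1)])
  have S: "set (map (braid_gen n m) u) \<subseteq> ?S" using u(1) by auto
  have "braid_length n m (braid_lift n m w) \<le> len w"
    using length_wrt_le[OF S prod] u by (simp add: braid_length_def lift)
  moreover have "len w \<le> braid_length n m (braid_lift n m w)"
  proof -
    obtain ys where ys: "set ys \<subseteq> ?S" "list_prod ?B ys = braid_class ?pu"
      "length ys = braid_length n m (braid_lift n m w)"
      using length_wrt_witness[OF S prod] unfolding braid_length_def lift by blast
    have sub: "?S \<subseteq> (\<lambda>l. braid_class [l]) ` ({1..n} \<times> UNIV)"
      by (auto simp: braid_gen_def generator_def braid_group_def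
          inv_generator[unfolded generator_def] simp del: Image_singleton_iff intro!: image_eqI)
    have "ys \<in> lists ((\<lambda>l. braid_class [l]) ` ({1..n} \<times> UNIV))"
      using subset_trans[OF ys(1) sub] by (simp only: lists_eq_set mem_Collect_eq)
    then have "ys \<in> map (\<lambda>l. braid_class [l]) ` words {1..n}"
      by (simp only: lists_image words_def)
    then obtain x where x: "x \<in> words {1..n}" "ys = map (\<lambda>l. braid_class [l]) x" by blast
    have pu: "?pu \<in> words {1..n}" using u by (auto simp: words_def)
    have "braid_class x = braid_class ?pu"
      using ys(2) list_prod_letter_classes[OF x(1), of "braid_relators n m"]
      unfolding x(2) braid_group_def by metis
    then have "cox_eq x ?pu"
      using braid_eq_imp_cox_eq word_class_eq_iff[OF x(1) pu] by blast
    then have "elt (map fst x) = w"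
      using cox_eq_iff[OF x(1) pu] u(2) by (simp add: comp_def)
    moreover have "set (map fst x) \<subseteq> {1..n}" using x(1) by (auto simp: words_def)
    ultimately show ?thesis using len_le[of "map fst x"] ys(3) x(2) by auto
  qed
  ultimately show ?thesis by (rule antisym)
qed

section \<open>Sums over the group\<close>

lemma sum_left_translate: "g \<in> carrier W \<Longrightarrow> (\<Sum>w\<in>carrier W. h (g \<star> w)) = (\<Sum>w\<in>carrier W. h w)"
  by (rule sum.reindex_bij_witness[of _ "\<lambda>w. inv\<^bsub>W\<^esub> g \<star> w" "\<lambda>w. g \<star> w"])
    (auto simp flip: m_assoc)

abbreviation sgn_len :: "letter list set \<Rightarrow> real" where
  "sgn_len w \<equiv> (- 1) ^ len w"

lemma even_len_mult:
  assumes "v \<in> carrier W" "w \<in> carrier W"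
  shows "even (len (v \<star> w)) \<longleftrightarrow> (even (len v) \<longleftrightarrow> even (len w))"
proof -
  obtain x y where "set x \<subseteq> {1..n}" "elt x = v" "set y \<subseteq> {1..n}" "elt y = w"
    using carrier_elt assms by metis
  then show ?thesis using even_len[of x] even_len[of y] even_len[of "x @ y"] by auto
qed

lemma sgn_len_eq: "sgn_len w = (if even (len w) then 1 else - 1)"
  by simp

lemma sgn_len_s_mult:
  "i \<in> {1..n} \<Longrightarrow> w \<in> carrier W \<Longrightarrow> sgn_len (s i \<star> w) = - sgn_len w"
  using even_len_s_mult[of i w] by (simp add: sgn_len_eq)

lemma sum_sgn_len:
  assumes "i \<in> {1..n}" shows "(\<Sum>w\<in>carrier W. sgn_len w) = 0"
  using sum_left_translate[of "s i" sgn_len] assms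
  by (simp add: sgn_len_s_mult sum_negf cong: sum.cong)

lemma alternating_snoc: "even k \<Longrightarrow> alternating k i j @ [i] = alternating (Suc k) i j"
  by (simp add: alternating_def)

text \<open>For even \<open>d\<close> the longest element \<open>z = (s\<^sub>i s\<^sub>j)\<^sup>d\<^sup>/\<^sup>2\<close> of the dihedral subgroup is central in that subgroup
  and has even length \<open>d\<close>.\<close>

lemma reversing_element:
  assumes ij: "i \<in> {1..n}" "j \<in> {1..n}" "i \<noteq> j" "m i j = enat d" "even d"
  obtains z where "z \<in> carrier W" "even (len z)" "s i \<in> inversions z" "inv\<^bsub>W\<^esub> z \<star> s i \<star> z = s i"
proof -
  define z where "z = elt (alternating d i j)"
  have w: "set (alternating d i j) \<subseteq> {1..n}" "set (alternating d j i) \<subseteq> {1..n}"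
    using set_alternating[of d i j] set_alternating[of d j i] ij by auto
  have z: "z \<in> carrier W" "even (len z)"
    using w even_len[OF w(1)] ij by (auto simp: z_def)
  have "2 \<le> d" using m_ge_2[OF ij(1-3)] ij(4) by simp
  have "p = 0" if p: "p < d" "s i = (s i \<star> s j) [^]\<^bsub>W\<^esub> p \<star> s i" for p
  proof (rule ccontr)
    assume "p \<noteq> 0"
    have "(s i \<star> s j) [^]\<^bsub>W\<^esub> p = \<one>\<^bsub>W\<^esub>"
      using p(2) ij by (metis l_cancel_one' m_closed nat_pow_closed r_cancel_one' s_closed)
    then show False using order_s_mult_s[OF ij(1-3), of p] \<open>p \<noteq> 0\<close> p(1) ij(4) by simp
  qed
  then have "{p. p < d \<and> s i = (s i \<star> s j) [^]\<^bsub>W\<^esub> p \<star> s i} = {0}"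
    using \<open>2 \<le> d\<close> ij by auto
  then have inv: "s i \<in> inversions z"
    using odd_crossing_alternating[of "s i" i j d] mem_inversions_elt[OF w(1)] ij by (simp add: z_def)
  have "z \<star> s i = elt (alternating d i j @ [i])" using w ij by (simp add: z_def)
  also have "\<dots> = elt (i # alternating d j i)"
    using ij(5) by (simp only: alternating_snoc alternating_Suc)
  also have "\<dots> = s i \<star> z" using elt_braid[OF ij(1,2,4)] by (simp add: z_def)
  finally have "inv\<^bsub>W\<^esub> z \<star> s i \<star> z = inv\<^bsub>W\<^esub> z \<star> (z \<star> s i)" using z ij by (simp add: m_assoc)
  also have "\<dots> = s i" using z ij by (simp flip: m_assoc)
  finally show ?thesis using that z inv by blast
qed

text \<open>Translating the sum by \<open>s\<^sub>i\<close> flips the signs, which reduces the claim to the vanishing of the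
  signed sum of \<open>\<epsilon> w = \<ell>(s\<^sub>i w) - \<ell>(w)\<close>.  Translating that sum by the element \<open>z\<close> of the previous
  lemma keeps the signs and negates \<open>\<epsilon>\<close>.\<close>

lemma sum_sgn_len_mult_len:
  assumes "i \<in> {1..n}" "j \<in> {1..n}" "i \<noteq> j" "m i j = enat d" "even d"
  shows "(\<Sum>w\<in>carrier W. sgn_len w * real (len w)) = 0" (is "?S = 0")
proof -
  define \<epsilon> :: "letter list set \<Rightarrow> real" where "\<epsilon> w = (if s i \<in> inversions w then - 1 else 1)" for w
  have len: "real (len (s i \<star> w)) = real (len w) + \<epsilon> w" if "w \<in> carrier W" for w
    using len_s_mult[OF assms(1) that] by (auto simp: \<epsilon>_def)
  obtain z where z: "z \<in> carrier W" "even (len z)" "s i \<in> inversions z" "inv\<^bsub>W\<^esub> z \<star> s i \<star> z = s i"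
    using reversing_element[OF assms] .
  have flip: "sgn_len (z \<star> w) * \<epsilon> (z \<star> w) = - (sgn_len w * \<epsilon> w)" if "w \<in> carrier W" for w
    using mem_inversions_mult[OF z(1) that, of "s i"] z even_len_mult[OF z(1) that] assms(1)
    by (auto simp: \<epsilon>_def sgn_len_eq)
  have "(\<Sum>w\<in>carrier W. sgn_len w * \<epsilon> w) = (\<Sum>w\<in>carrier W. - (sgn_len w * \<epsilon> w))"
    using sum_left_translate[OF z(1), of "\<lambda>w. sgn_len w * \<epsilon> w"] flip by simp
  then have 0: "(\<Sum>w\<in>carrier W. sgn_len w * \<epsilon> w) = 0" by (simp add: sum_negf)
  have "?S = (\<Sum>w\<in>carrier W. sgn_len (s i \<star> w) * real (len (s i \<star> w)))"
    using sum_left_translate[of "s i" "\<lambda>w. sgn_len w * real (len w)"] assms(1) by simp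
  also have "\<dots> = (\<Sum>w\<in>carrier W. - (sgn_len w * real (len w)) - sgn_len w * \<epsilon> w)"
    using assms(1) by (intro sum.cong) (auto simp: sgn_len_s_mult len algebra_simps)
  also have "\<dots> = - ?S" using 0 by (simp add: sum_subtractf sum_negf)
  finally show ?thesis by simp
qed

text \<open>Count pairs of an element and an inversion of it.  For a fixed reflection \<open>t\<close>, exactly one of \<open>w\<close>
  and \<open>t w\<close> has the inversion \<open>t\<close>.\<close>

lemma sum_len:
  assumes fin: "finite (carrier W)"
  shows "2 * (\<Sum>w\<in>carrier W. real (len w)) = real (card (carrier W)) * real (card (reflections n m))"
proof -
  let ?T = "reflections n m"
  have finT: "finite ?T" using fin reflections_subset finite_subset by blast
  have len: "real (len w) = (\<Sum>t\<in>?T. of_bool (t \<in> inversions w))" if "w \<in> carrier W" for w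
    using inversions_card_subset[OF that] finT by (simp add: sum.If_cases of_bool_def Int_absorb1)
  have half: "2 * (\<Sum>w\<in>carrier W. of_bool (t \<in> inversions w)) = real (card (carrier W))"
    if t: "t \<in> ?T" for t
  proof -
    have "(\<Sum>w\<in>carrier W. of_bool (t \<in> inversions w)) + (\<Sum>w\<in>carrier W. of_bool (t \<in> inversions w))
        = (\<Sum>w\<in>carrier W. of_bool (t \<in> inversions w)) + (\<Sum>w\<in>carrier W. of_bool (t \<in> inversions (t \<star> w)) :: real)"
      using sum_left_translate[of t "\<lambda>w. of_bool (t \<in> inversions w) :: real"] t reflections_subset by auto
    also have "\<dots> = (\<Sum>w\<in>carrier W. 1)"
      unfolding sum.distrib[symmetric]
      by (intro sum.cong HOL.refl) (simp add: mem_inversions_reflection_mult[OF t])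
    finally show ?thesis by simp
  qed
  have "(\<Sum>w\<in>carrier W. real (len w)) = (\<Sum>w\<in>carrier W. \<Sum>t\<in>?T. of_bool (t \<in> inversions w))"
    using len by simp
  also have "\<dots> = (\<Sum>t\<in>?T. \<Sum>w\<in>carrier W. of_bool (t \<in> inversions w))"
    by (rule sum.swap)
  finally have "2 * (\<Sum>w\<in>carrier W. real (len w))
      = (\<Sum>t\<in>?T. 2 * (\<Sum>w\<in>carrier W. of_bool (t \<in> inversions w)))"
    by (simp only: sum_distrib_left)
  also have "\<dots> = (\<Sum>t\<in>?T. real (card (carrier W)))"
    by (intro sum.cong HOL.refl half)
  finally show ?thesis by simp
qed

text \<open>If some \<open>m i j\<close> is even, the mean length over the elements of even length, and over those of odd
  length, is half the number of reflections.\<close>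

lemma sum_parity_class:
  assumes fin: "finite (carrier W)"
    and ij: "i \<in> {1..n}" "j \<in> {1..n}" "i \<noteq> j" "m i j = enat d" "even d"
  shows "(\<Sum>w\<in>{w \<in> carrier W. even (len w) = q}. real (len w) - real (card (reflections n m)) / 2) = 0"
proof -
  let ?h = "\<lambda>w. real (len w) - real (card (reflections n m)) / 2"
  \<comment> \<open>\<open>(1 + \<eta> (-1)\<^sup>\<ell>\<^sup>(\<^sup>w\<^sup>)) / 2\<close> is the indicator of the parity class.\<close>
  define \<eta> :: real where "\<eta> = (if q then 1 else - 1)"
  have 1: "(\<Sum>w\<in>carrier W. ?h w) = 0"
    using sum_len[OF fin] by (simp add: sum_subtractf)
  have 2: "(\<Sum>w\<in>carrier W. sgn_len w * ?h w) = 0"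
    using sum_sgn_len_mult_len[OF ij] sum_sgn_len[OF ij(1)]
    by (simp add: right_diff_distrib sum_subtractf flip: sum_distrib_right sum_divide_distrib)
  have "(\<Sum>w\<in>{w \<in> carrier W. even (len w) = q}. ?h w)
      = (\<Sum>w\<in>carrier W. if even (len w) = q then ?h w else 0)"
    by (rule sum.inter_filter[OF fin])
  also have "\<dots> = (\<Sum>w\<in>carrier W. (?h w + \<eta> * (sgn_len w * ?h w)) / 2)"
    by (intro sum.cong) (auto simp: \<eta>_def sgn_len_eq)
  also have "\<dots> = ((\<Sum>w\<in>carrier W. ?h w) + \<eta> * (\<Sum>w\<in>carrier W. sgn_len w * ?h w)) / 2"
    unfolding sum_divide_distrib[symmetric] sum.distrib sum_distrib_left ..
  also have "\<dots> = 0" unfolding 1 2 by simp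
  finally show ?thesis .
qed
end

section \<open>Powers of a stochastic matrix\<close>

primrec mat_pow :: "'a set \<Rightarrow> ('a \<Rightarrow> 'a \<Rightarrow> real) \<Rightarrow> nat \<Rightarrow> 'a \<Rightarrow> 'a \<Rightarrow> real" where
  "mat_pow A P 0 = (\<lambda>a b. of_bool (a = b))"
| "mat_pow A P (Suc k) = (\<lambda>a b. \<Sum>c\<in>A. P a c * mat_pow A P k c b)"

definition mat_apply :: "'a set \<Rightarrow> ('a \<Rightarrow> 'a \<Rightarrow> real) \<Rightarrow> ('a \<Rightarrow> real) \<Rightarrow> 'a \<Rightarrow> real" where
  "mat_apply A P f a = (\<Sum>b\<in>A. P a b * f b)"

lemma mat_pow_add:
  assumes "finite A" "a \<in> A"
  shows "mat_pow A P (j + k) a b = (\<Sum>c\<in>A. mat_pow A P j a c * mat_pow A P k c b)"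
  using assms(2)
proof (induction j arbitrary: a)
  case 0
  then show ?case using assms(1) by (simp add: of_bool_def if_distrib[of "\<lambda>x. x * _"] cong: if_cong)
next
  case (Suc j)
  have "mat_pow A P (Suc j + k) a b = (\<Sum>d\<in>A. P a d * (\<Sum>c\<in>A. mat_pow A P j d c * mat_pow A P k c b))"
    using Suc.IH by simp
  also have "\<dots> = (\<Sum>c\<in>A. \<Sum>d\<in>A. P a d * mat_pow A P j d c * mat_pow A P k c b)"
    by (subst sum.swap) (simp add: sum_distrib_left mult.assoc)
  also have "\<dots> = (\<Sum>c\<in>A. mat_pow A P (Suc j) a c * mat_pow A P k c b)"
    by (simp add: sum_distrib_right)
  finally show ?case .
qed

lemma mat_pow_Suc_right:
  assumes "finite A" "a \<in> A" "b \<in> A"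
  shows "mat_pow A P (Suc k) a b = (\<Sum>c\<in>A. mat_pow A P k a c * P c b)"
proof -
  have "mat_pow A P 1 c b = P c b" if "c \<in> A" for c
    using assms by (simp add: of_bool_def One_nat_def if_distrib[of "\<lambda>x. _ * x"] cong: if_cong)
  then show ?thesis unfolding Suc_eq_plus1 mat_pow_add[OF assms(1,2)] by (intro sum.cong) simp_all
qed

lemma mat_apply_pow_add:
  assumes "finite A" "a \<in> A"
  shows "mat_apply A (mat_pow A P (j + k)) f a
    = mat_apply A (mat_pow A P j) (mat_apply A (mat_pow A P k) f) a"
proof -
  have "mat_apply A (mat_pow A P (j + k)) f a
      = (\<Sum>b\<in>A. \<Sum>c\<in>A. mat_pow A P j a c * mat_pow A P k c b * f b)"
    using assms by (simp add: mat_apply_def mat_pow_add sum_distrib_right)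
  also have "\<dots> = mat_apply A (mat_pow A P j) (mat_apply A (mat_pow A P k) f) a"
    by (subst sum.swap) (simp add: mat_apply_def sum_distrib_left mult.assoc)
  finally show ?thesis .
qed

lemma mat_apply_pow_Suc:
  "mat_apply A (mat_pow A P (Suc k)) f a = mat_apply A P (mat_apply A (mat_pow A P k) f) a"
proof -
  have "mat_apply A (mat_pow A P (Suc k)) f a = (\<Sum>b\<in>A. \<Sum>c\<in>A. P a c * mat_pow A P k c b * f b)"
    by (simp add: mat_apply_def sum_distrib_right)
  also have "\<dots> = mat_apply A P (mat_apply A (mat_pow A P k) f) a"
    by (subst sum.swap) (simp add: mat_apply_def sum_distrib_left mult.assoc)
  finally show ?thesis .
qed

locale finite_stochastic =
  fixes A :: "'a set" and P :: "'a \<Rightarrow> 'a \<Rightarrow> real"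
  assumes finite: "finite A" and stochastic: "stochastic_on A P"
begin

lemma nonneg: "a \<in> A \<Longrightarrow> b \<in> A \<Longrightarrow> 0 \<le> P a b"
  and row_sum: "a \<in> A \<Longrightarrow> (\<Sum>b\<in>A. P a b) = 1"
  using stochastic finite by (auto simp: stochastic_on_def has_sum_finite_iff)

lemma pow_nonneg: "a \<in> A \<Longrightarrow> b \<in> A \<Longrightarrow> 0 \<le> mat_pow A P k a b"
  by (induction k arbitrary: a) (auto intro!: sum_nonneg mult_nonneg_nonneg nonneg)

lemma pow_row_sum: "a \<in> A \<Longrightarrow> (\<Sum>b\<in>A. mat_pow A P k a b) = 1"
proof (induction k arbitrary: a)
  case 0
  then show ?case using finite by (simp add: of_bool_def)
next
  case (Suc k)
  have "(\<Sum>b\<in>A. mat_pow A P (Suc k) a b) = (\<Sum>c\<in>A. P a c * (\<Sum>b\<in>A. mat_pow A P k c b))"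
    by (simp add: sum_distrib_left) (rule sum.swap)
  then show ?case using Suc row_sum by simp
qed

lemma pow_stochastic: "finite_stochastic A (mat_pow A P k)"
  using finite pow_nonneg pow_row_sum
  by unfold_locales (auto simp: stochastic_on_def has_sum_finite_iff)

lemma pow_pos_trans:
  assumes "a \<in> A" "b \<in> A" "c \<in> A" "0 < mat_pow A P j a b" "0 < mat_pow A P k b c"
  shows "0 < mat_pow A P (j + k) a c"
proof -
  have "0 < mat_pow A P j a b * mat_pow A P k b c" using assms by simp
  also have "\<dots> \<le> (\<Sum>d\<in>A. mat_pow A P j a d * mat_pow A P k d c)"
    using assms finite pow_nonneg by (intro member_le_sum) auto
  finally show ?thesis using mat_pow_add[OF finite assms(1), of P j k c] by simp
qed

lemma pow_1: "a \<in> A \<Longrightarrow> b \<in> A \<Longrightarrow> mat_pow A P 1 a b = P a b"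
  using mat_pow_Suc_right[OF finite, of a b P 0] finite by (simp add: One_nat_def of_bool_def if_distrib[of "\<lambda>x. x * _"] cong: if_cong)

text \<open>Doeblin's argument: subtracting from row \<open>a\<close> the constant \<open>\<delta>\<close> on a set where \<open>h\<close> has sum zero does
  not change the result, but lowers the mass of the row.\<close>

lemma contraction:
  assumes "a \<in> A" "D \<subseteq> A" "D \<noteq> {}" "0 \<le> \<delta>" "\<And>b. b \<in> D \<Longrightarrow> \<delta> \<le> P a b"
    and h: "(\<Sum>b\<in>D. h b) = 0" "\<And>b. b \<in> A \<Longrightarrow> \<bar>h b\<bar> \<le> c"
  shows "\<bar>mat_apply A P h a\<bar> \<le> (1 - \<delta>) * c"
proof -
  define R where "R b = P a b - (if b \<in> D then \<delta> else 0)" for b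
  have R: "0 \<le> R b" if "b \<in> A" for b using nonneg[OF assms(1) that] assms(5)[of b] by (simp add: R_def)
  have D: "(\<Sum>b\<in>A. (if b \<in> D then \<delta> else 0) * g b) = \<delta> * (\<Sum>b\<in>D. g b)" for g :: "'a \<Rightarrow> real"
    using finite assms(2) by (simp add: sum_distrib_left sum.inter_restrict[symmetric] Int_absorb1 if_distrib[of "\<lambda>x. x * _"] cong: if_cong)
  have "0 \<le> c" using h(2)[OF assms(1)] by linarith
  have "finite D" using assms(2) finite finite_subset by blast
  then have card: "1 \<le> real (card D)" using assms(3) by (simp add: One_nat_def Suc_le_eq card_gt_0_iff)
  have "mat_apply A P h a = (\<Sum>b\<in>A. R b * h b)"
    using D[of h] h(1) by (simp add: mat_apply_def R_def left_diff_distrib sum_subtractf)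
  also have "\<bar>\<dots>\<bar> \<le> (\<Sum>b\<in>A. R b * c)"
    using R h(2) by (intro order.trans[OF sum_abs] sum_mono) (auto simp: abs_mult intro!: mult_mono)
  also have "\<dots> = (1 - \<delta> * card D) * c"
    using D[of "\<lambda>_. 1"] row_sum[OF assms(1)] by (simp add: R_def sum_subtractf flip: sum_distrib_right)
  also have "\<dots> \<le> (1 - \<delta>) * c"
    using mult_left_mono[OF card assms(4)] \<open>0 \<le> c\<close> by (intro mult_right_mono) auto
  finally show ?thesis .
qed

lemma mat_apply_bound:
  assumes "a \<in> A" "\<And>b. b \<in> A \<Longrightarrow> \<bar>h b\<bar> \<le> c"
  shows "\<bar>mat_apply A P h a\<bar> \<le> c"
proof -
  have "\<bar>mat_apply A P h a\<bar> \<le> (\<Sum>b\<in>A. P a b * c)"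
    unfolding mat_apply_def
    using nonneg[OF assms(1)] assms(2) by (intro order.trans[OF sum_abs] sum_mono) (auto simp: abs_mult intro!: mult_mono)
  then show ?thesis using row_sum[OF assms(1)] by (simp flip: sum_distrib_right)
qed

text \<open>The sets \<open>D a\<close> allow for periodicity: they are either the whole state space or the class of \<open>a\<close> in
  a partition into two periodic classes.  Every \<open>N\<close> steps contract the maximum norm by a fixed
  factor.\<close>

lemma powers_vanish:
  assumes D: "\<And>a. a \<in> A \<Longrightarrow> D a \<subseteq> A" "\<And>a. a \<in> A \<Longrightarrow> a \<in> D a"
    and zero: "\<And>k a. a \<in> A \<Longrightarrow> (\<Sum>b\<in>D a. mat_apply A (mat_pow A P k) f b) = 0"
    and pos: "\<And>a b. a \<in> A \<Longrightarrow> b \<in> D a \<Longrightarrow> 0 < mat_pow A P N a b"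
    and a: "a \<in> A"
  shows "(\<lambda>k. mat_apply A (mat_pow A P k) f a) \<longlonglongrightarrow> 0"
proof -
  define F where "F k = mat_apply A (mat_pow A P k) f" for k
  define E where "E = (\<lambda>(a, b). mat_pow A P N a b) ` (SIGMA a:A. D a)"
  define \<delta> where "\<delta> = Min E"
  have "finite (SIGMA a:A. D a)" using finite D(1) finite_subset by blast
  then have E: "finite E" "E \<noteq> {}" using a D(2)[OF a] by (auto simp: E_def)
  then have "\<delta> \<in> E" by (simp add: \<delta>_def)
  then have "0 < \<delta>" using pos by (auto simp: E_def)
  have \<delta>: "\<delta> \<le> mat_pow A P N a b" if "a \<in> A" "b \<in> D a" for a b
    unfolding \<delta>_def using E(1) that by (intro Min_le) (auto simp: E_def)
  have "mat_pow A P N a a \<le> (\<Sum>b\<in>A. mat_pow A P N a b)"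
    using a finite pow_nonneg by (intro member_le_sum) auto
  then have "\<delta> \<le> 1" using \<delta>[OF a D(2)[OF a]] pow_row_sum[OF a] by simp
  interpret N: finite_stochastic A "mat_pow A P N" by (rule pow_stochastic)
  define C where "C = (\<Sum>b\<in>A. \<bar>F 0 b\<bar>)"
  have mono: "\<forall>a\<in>A. \<bar>F (j + k) a\<bar> \<le> c" if "\<forall>a\<in>A. \<bar>F j a\<bar> \<le> c" for j k c
  proof (induction k)
    case (Suc k)
    then show ?case
      using mat_apply_bound[of _ "F (j + k)" c] by (simp add: F_def mat_apply_pow_Suc del: mat_pow.simps)
  qed (use that in simp)
  have geom: "\<forall>a\<in>A. \<bar>F (j * N) a\<bar> \<le> (1 - \<delta>) ^ j * C" for j
  proof (induction j)
    case 0
    show ?case using finite by (auto simp: C_def intro!: member_le_sum)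
  next
    case (Suc j)
    show ?case
    proof
      fix x assume x: "x \<in> A"
      have "F (Suc j * N) x = mat_apply A (mat_pow A P N) (F (j * N)) x"
        using mat_apply_pow_add[OF finite x, of P N "j * N" f] by (simp add: F_def)
      also have "\<bar>\<dots>\<bar> \<le> (1 - \<delta>) * ((1 - \<delta>) ^ j * C)"
      proof (rule N.contraction[of x "D x"])
        show "D x \<subseteq> A" "D x \<noteq> {}" using D[OF x] by auto
        show "(\<Sum>b\<in>D x. F (j * N) b) = 0" using zero[OF x] by (simp add: F_def)
      qed (use x \<delta>[OF x] \<open>0 < \<delta>\<close> Suc in auto)
      finally show "\<bar>F (Suc j * N) x\<bar> \<le> (1 - \<delta>) ^ Suc j * C" by (simp add: mult.assoc)
    qed
  qed
  have "(\<lambda>j. (1 - \<delta>) ^ j * C) \<longlonglongrightarrow> 0 * C"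
    using \<open>0 < \<delta>\<close> \<open>\<delta> \<le> 1\<close> by (intro tendsto_intros LIMSEQ_power_zero) auto
  then have lim: "(\<lambda>j. (1 - \<delta>) ^ j * C) \<longlonglongrightarrow> 0" by simp
  show ?thesis
  proof (rule LIMSEQ_I)
    fix e :: real assume "0 < e"
    then obtain j where j: "(1 - \<delta>) ^ j * C < e"
      using order_tendstoD(2)[OF lim] by (auto simp: eventually_sequentially)
    have "norm (mat_apply A (mat_pow A P k) f a - 0) < e" if "j * N \<le> k" for k
    proof -
      have "\<bar>F (j * N + (k - j * N)) a\<bar> \<le> (1 - \<delta>) ^ j * C"
        using mono[OF geom[of j], of "k - j * N"] a by blast
      then show ?thesis using that j by (simp add: F_def)
    qed
    then show "\<exists>n0. \<forall>k\<ge>n0. norm (mat_apply A (mat_pow A P k) f a - 0) < e" by blast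
  qed
qed

end

text \<open>If some transition keeps the colour, any two states are connected in exactly \<open>2N + 2\<close> steps, and
  column sums one preserve the total sum of \<open>f\<close>.  Otherwise every transition changes the colour, and
  column sums one make the sums over the two colour classes change places at each step.\<close>

lemma doubly_stochastic_powers_vanish:
  fixes P :: "'a \<Rightarrow> 'a \<Rightarrow> real" and col :: "'a \<Rightarrow> bool"
  assumes fin: "finite A" and ds: "doubly_stochastic_on A P"
    and conn: "\<And>k a b. N \<le> k \<Longrightarrow> a \<in> A \<Longrightarrow> b \<in> A \<Longrightarrow> even k = (col a = col b) \<Longrightarrow> 0 < mat_pow A P k a b"
    and zero: "\<And>q. (\<Sum>b\<in>{b \<in> A. col b = q}. f b) = 0"
    and a: "a \<in> A"
  shows "(\<lambda>k. mat_apply A (mat_pow A P k) f a) \<longlonglongrightarrow> 0"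
proof -
  interpret finite_stochastic A P
    using fin ds by unfold_locales (auto simp: stochastic_on_def doubly_stochastic_on_def)
  have column: "(\<Sum>a\<in>A. P a b) = 1" if "b \<in> A" for b
    using ds fin that by (auto simp: doubly_stochastic_on_def has_sum_finite_iff)
  have at0: "mat_apply A (mat_pow A P 0) f b = f b" if "b \<in> A" for b
    using that fin by (simp add: mat_apply_def of_bool_def if_distrib[of "\<lambda>x. x * _"] cong: if_cong)
  show ?thesis
  proof (cases "\<exists>x\<in>A. \<exists>y\<in>A. col x = col y \<and> 0 < P x y")
    case True
    then obtain x y where xy: "x \<in> A" "y \<in> A" "col x = col y" "0 < P x y" by blast
    have "0 < mat_pow A P (2 * N + 2) b c" if bc: "b \<in> A" "c \<in> A" for b c
    proof (cases "col b = col c")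
      case True
      then show ?thesis using bc by (intro conn) auto
    next
      case False
      \<comment> \<open>Go from \<open>b\<close> to \<open>x\<close> in \<open>k\<close> steps, use the transition that keeps the colour, and go
        from \<open>y\<close> to \<open>c\<close> in the remaining \<open>l\<close> steps; \<open>k\<close> has the parity that the colours require.\<close>
      define k where "k = (if even N = (col b = col x) then N else N + 1)"
      define l where "l = 2 * N + 1 - k"
      have "N \<le> k" "N \<le> l" "even k = (col b = col x)" "even l = (col y = col c)"
        and len: "2 * N + 2 = k + 1 + l"
        using False xy(3) by (auto simp: k_def l_def)
      then have "0 < mat_pow A P k b x" "0 < mat_pow A P 1 x y" "0 < mat_pow A P l y c"
        using conn[of k b x] conn[of l y c] pow_1[of x y] xy bc by simp_all
      then show ?thesis
        unfolding len using xy(1,2) bc by (meson pow_pos_trans)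
    qed
    moreover have "(\<Sum>b\<in>A. mat_apply A (mat_pow A P k) f b) = 0" for k
    proof (induction k)
      case 0
      have "(\<Sum>b\<in>A. f b) = (\<Sum>q\<in>UNIV. \<Sum>b\<in>{b \<in> A. col b = q}. f b)"
        using fin by (intro sum.group[symmetric]) auto
      then show ?case using zero at0 by simp
    next
      case (Suc k)
      let ?g = "mat_apply A (mat_pow A P k) f"
      have "(\<Sum>b\<in>A. mat_apply A (mat_pow A P (Suc k)) f b) = (\<Sum>c\<in>A. \<Sum>b\<in>A. P b c * ?g c)"
        unfolding mat_apply_pow_Suc unfolding mat_apply_def[of A P] by (rule sum.swap)
      also have "\<dots> = (\<Sum>c\<in>A. ?g c)" using column by (simp flip: sum_distrib_right)
      finally show ?case using Suc by simp
    qed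
    ultimately show ?thesis using a by (intro powers_vanish[of "\<lambda>_. A" f "2 * N + 2"]) auto
  next
    case False
    then have no: "P b c = 0" if "b \<in> A" "c \<in> A" "col b = col c" for b c
      using nonneg[OF that(1,2)] that by (metis order.not_eq_order_implies_strict)
    have "(\<Sum>b\<in>{b \<in> A. col b = q}. mat_apply A (mat_pow A P k) f b) = 0" for k q
    proof (induction k arbitrary: q)
      case 0
      then show ?case using zero[of q] at0 by simp
    next
      case (Suc k)
      let ?g = "mat_apply A (mat_pow A P k) f"
      have "(\<Sum>b\<in>{b \<in> A. col b = q}. P b c) = (if col c = q then 0 else 1)" if c: "c \<in> A" for c
      proof -
        have "(\<Sum>b\<in>{b \<in> A. col b = q}. P b c) = (\<Sum>b\<in>A. if col b = q then P b c else 0)"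
          by (rule sum.inter_filter[OF fin])
        also have "\<dots> = (\<Sum>b\<in>A. if col c = q then 0 else P b c)"
          using no c by (intro sum.cong) auto
        finally show ?thesis using column[OF c] by simp
      qed
      note col_sum = this
      have "(\<Sum>b\<in>{b \<in> A. col b = q}. mat_apply A (mat_pow A P (Suc k)) f b)
          = (\<Sum>c\<in>A. \<Sum>b\<in>{b \<in> A. col b = q}. P b c * ?g c)"
        unfolding mat_apply_pow_Suc unfolding mat_apply_def[of A P] by (rule sum.swap)
      also have "\<dots> = (\<Sum>c\<in>A. if col c = (\<not> q) then ?g c else 0)"
        using col_sum by (intro sum.cong) (auto simp flip: sum_distrib_right)
      also have "\<dots> = (\<Sum>c\<in>{c \<in> A. col c = (\<not> q)}. ?g c)"
        by (rule sum.inter_filter[OF fin, symmetric])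
      finally show ?case using Suc by simp
    qed
    moreover have "0 < mat_pow A P (2 * N + 2) b c" if "b \<in> A" "c \<in> {c \<in> A. col c = col b}" for b c
      using that by (intro conn) auto
    ultimately show ?thesis
      using a by (intro powers_vanish[of "\<lambda>b. {c \<in> A. col c = col b}" f "2 * N + 2"]) auto
  qed
qed

section \<open>Distribution of a Markov chain\<close>

lemma (in prob_space) prob_partition:
  assumes "finite H" "\<And>\<omega>. \<omega> \<in> space M \<Longrightarrow> Y \<omega> \<in> H"
    and "\<And>h. h \<in> H \<Longrightarrow> {\<omega> \<in> space M. Q \<omega> \<and> Y \<omega> = h} \<in> events"
  shows "\<P>(\<omega> in M. Q \<omega>) = (\<Sum>h\<in>H. \<P>(\<omega> in M. Q \<omega> \<and> Y \<omega> = h))"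
proof -
  have "{\<omega> \<in> space M. Q \<omega>} = (\<Union>h\<in>H. {\<omega> \<in> space M. Q \<omega> \<and> Y \<omega> = h})"
    using assms(2) by auto
  then show ?thesis
    using assms by (simp only:) (rule finite_measure_finite_Union, auto simp: disjoint_family_on_def)
qed

locale finite_markov_chain =
  fixes M :: "'o measure" and A :: "'a set" and x0 :: 'a and P :: "'a \<Rightarrow> 'a \<Rightarrow> real"
    and X :: "nat \<Rightarrow> 'o \<Rightarrow> 'a"
  assumes chain: "markov_chain M A x0 P X" and finite_states: "finite A" and start: "x0 \<in> A"
begin

sublocale prob_space M
  using chain by (simp add: markov_chain_def)

lemma X_in: "\<omega> \<in> space M \<Longrightarrow> X k \<omega> \<in> A"
  using chain measurable_space[of "X k" M "count_space A" \<omega>] by (simp add: markov_chain_def)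

lemma X_event: "{\<omega> \<in> space M. X k \<omega> = b} \<in> events"
proof -
  have "X k -` ({b} \<inter> A) \<inter> space M \<in> events"
    using chain by (intro measurable_sets[of "X k" M "count_space A"]) (auto simp: markov_chain_def)
  also have "X k -` ({b} \<inter> A) \<inter> space M = {\<omega> \<in> space M. X k \<omega> = b}" using X_in by auto
  finally show ?thesis .
qed

lemma history_event: "{\<omega> \<in> space M. \<forall>i\<le>k. X i \<omega> = h i} \<in> events"
proof -
  have "{\<omega> \<in> space M. \<forall>i\<in>{..k}. X i \<omega> = h i} \<in> events"
    using X_event by (rule sets.sets_Collect_finite_All) simp
  then show ?thesis by (simp only: Ball_def atMost_iff)
qed

lemma prob_step_history:
  assumes "\<And>i. i \<le> k \<Longrightarrow> h i \<in> A" "b \<in> A"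
  shows "\<P>(\<omega> in M. X (Suc k) \<omega> = b \<and> (\<forall>i\<le>k. X i \<omega> = h i))
    = \<P>(\<omega> in M. \<forall>i\<le>k. X i \<omega> = h i) * P (h k) b"
proof (cases "\<P>(\<omega> in M. \<forall>i\<le>k. X i \<omega> = h i) > 0")
  case True
  then have "\<P>(\<omega> in M. X (Suc k) \<omega> = b \<bar> \<forall>i\<le>k. X i \<omega> = h i) = P (h k) b"
    using chain[unfolded markov_chain_def, THEN conjunct2, THEN conjunct2, THEN conjunct2,
        THEN conjunct2, rule_format, of k h b] assms by simp
  then show ?thesis using True by (simp add: cond_prob_def field_simps)
next
  case False
  then have 0: "\<P>(\<omega> in M. \<forall>i\<le>k. X i \<omega> = h i) = 0" by (simp add: zero_less_measure_iff)
  have "\<P>(\<omega> in M. X (Suc k) \<omega> = b \<and> (\<forall>i\<le>k. X i \<omega> = h i)) \<le> \<P>(\<omega> in M. \<forall>i\<le>k. X i \<omega> = h i)"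
    by (intro finite_measure_mono history_event) auto
  then show ?thesis unfolding 0 by (simp add: measure_le_0_iff)
qed

lemma prob_history_split:
  assumes "{\<omega> \<in> space M. Q \<omega>} \<in> events"
  shows "\<P>(\<omega> in M. Q \<omega>) = (\<Sum>h\<in>{..k} \<rightarrow>\<^sub>E A. \<P>(\<omega> in M. Q \<omega> \<and> (\<forall>i\<le>k. X i \<omega> = h i)))"
proof -
  have eq: "restrict (\<lambda>i. X i \<omega>) {..k} = h \<longleftrightarrow> (\<forall>i\<le>k. X i \<omega> = h i)" if "h \<in> {..k} \<rightarrow>\<^sub>E A" for h \<omega>
    using that by (auto simp: PiE_def extensional_def fun_eq_iff)
  have "\<P>(\<omega> in M. Q \<omega>) = (\<Sum>h\<in>{..k} \<rightarrow>\<^sub>E A. \<P>(\<omega> in M. Q \<omega> \<and> restrict (\<lambda>i. X i \<omega>) {..k} = h))"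
  proof (rule prob_partition)
    show "finite ({..k} \<rightarrow>\<^sub>E A)" using finite_states by (intro finite_PiE) auto
    show "restrict (\<lambda>i. X i \<omega>) {..k} \<in> {..k} \<rightarrow>\<^sub>E A" if "\<omega> \<in> space M" for \<omega>
      using X_in[OF that] by auto
    show "{\<omega> \<in> space M. Q \<omega> \<and> restrict (\<lambda>i. X i \<omega>) {..k} = h} \<in> events" if "h \<in> {..k} \<rightarrow>\<^sub>E A" for h
      unfolding eq[OF that] by (intro sets.sets_Collect_conj assms history_event)
  qed
  then show ?thesis using eq by simp
qed

text \<open>The Markov property conditions on complete histories, so the joint law of two consecutive states
  is obtained as a sum over all histories.\<close>

lemma prob_step:
  assumes b: "b \<in> A"
  shows "\<P>(\<omega> in M. X (Suc k) \<omega> = b) = (\<Sum>c\<in>A. \<P>(\<omega> in M. X k \<omega> = c) * P c b)"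
proof -
  let ?H = "{..k} \<rightarrow>\<^sub>E A"
  let ?p = "\<lambda>h. \<P>(\<omega> in M. \<forall>i\<le>k. X i \<omega> = h i)"
  have c: "\<P>(\<omega> in M. X k \<omega> = c \<and> (\<forall>i\<le>k. X i \<omega> = h i)) = (if h k = c then ?p h else 0)" for c h
  proof (cases "h k = c")
    case True
    then have "(X k \<omega> = c \<and> (\<forall>i\<le>k. X i \<omega> = h i)) = (\<forall>i\<le>k. X i \<omega> = h i)" for \<omega> by auto
    then show ?thesis using True by simp
  next
    case False
    then have "{\<omega> \<in> space M. X k \<omega> = c \<and> (\<forall>i\<le>k. X i \<omega> = h i)} = {}" by auto
    then show ?thesis using False by (simp only:) simp
  qed
  have hk: "h k \<in> A" if "h \<in> ?H" for h using that by auto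
  have "\<P>(\<omega> in M. X (Suc k) \<omega> = b) = (\<Sum>h\<in>?H. \<P>(\<omega> in M. X (Suc k) \<omega> = b \<and> (\<forall>i\<le>k. X i \<omega> = h i)))"
    by (intro prob_history_split X_event)
  also have "\<dots> = (\<Sum>h\<in>?H. ?p h * P (h k) b)"
    using b by (intro sum.cong HOL.refl prob_step_history) auto
  also have "\<dots> = (\<Sum>h\<in>?H. \<Sum>c\<in>A. (if h k = c then ?p h else 0) * P c b)"
    using hk finite_states by (intro sum.cong) (auto simp: if_distrib[of "\<lambda>x. x * _"] cong: if_cong)
  also have "\<dots> = (\<Sum>c\<in>A. (\<Sum>h\<in>?H. if h k = c then ?p h else 0) * P c b)"
    by (subst sum.swap) (simp add: sum_distrib_right)
  also have "\<dots> = (\<Sum>c\<in>A. \<P>(\<omega> in M. X k \<omega> = c) * P c b)"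
  proof (intro sum.cong HOL.refl arg_cong2[of _ _ _ _ "(*)"])
    fix c
    show "(\<Sum>h\<in>?H. if h k = c then ?p h else 0) = \<P>(\<omega> in M. X k \<omega> = c)"
      unfolding prob_history_split[OF X_event, of k c k] c ..
  qed
  finally show ?thesis .
qed

lemma distribution: "b \<in> A \<Longrightarrow> \<P>(\<omega> in M. X k \<omega> = b) = mat_pow A P k x0 b"
proof (induction k arbitrary: b)
  case 0
  have ae: "AE \<omega> in M. X 0 \<omega> = x0" using chain by (simp add: markov_chain_def)
  show ?case
  proof (cases "b = x0")
    case True
    then show ?thesis using ae prob_Collect_eq_1[OF X_event, of 0 x0] by simp
  next
    case False
    then have "AE \<omega> in M. X 0 \<omega> \<noteq> b" using ae by auto
    then show ?thesis using False prob_Collect_eq_0[OF X_event, of 0 b] by simp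
  qed
next
  case (Suc k)
  show ?case
    unfolding mat_pow_Suc_right[OF finite_states start Suc.prems] prob_step[OF Suc.prems]
    using Suc.IH by simp
qed

lemma expectation_eq:
  fixes f :: "'a \<Rightarrow> real"
  shows "expectation (\<lambda>\<omega>. f (X k \<omega>)) = mat_apply A (mat_pow A P k) f x0"
proof -
  have "expectation (\<lambda>\<omega>. f (X k \<omega>))
      = expectation (\<lambda>\<omega>. \<Sum>b\<in>A. f b * indicator {\<omega> \<in> space M. X k \<omega> = b} \<omega>)"
  proof (rule Bochner_Integration.integral_cong)
    fix \<omega> assume "\<omega> \<in> space M"
    then have "f b * indicator {\<omega> \<in> space M. X k \<omega> = b} \<omega> = (if X k \<omega> = b then f b else 0)" for b
      by (simp add: indicator_def)
    then show "f (X k \<omega>) = (\<Sum>b\<in>A. f b * indicator {\<omega> \<in> space M. X k \<omega> = b} \<omega>)"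
      using finite_states X_in[OF \<open>\<omega> \<in> space M\<close>] by simp
  qed simp
  also have "\<dots> = (\<Sum>b\<in>A. f b * \<P>(\<omega> in M. X k \<omega> = b))"
    using X_event by (subst Bochner_Integration.integral_sum)
      (auto intro!: integrable_mult_right integrable_real_indicator simp: emeasure_eq_measure Int_def conj_commute)
  also have "\<dots> = mat_apply A (mat_pow A P k) f x0"
    using distribution by (simp add: mat_apply_def mult.commute)
  finally show ?thesis .
qed

end

section \<open>The expected length of the random walk\<close>

context coxeter
begin

lemma pow_pos_along_word:
  assumes "finite_stochastic (carrier W) P"
    and step: "\<And>a i. a \<in> carrier W \<Longrightarrow> i \<in> {1..n} \<Longrightarrow> 0 < P a (a \<star> s i)"
    and "set u \<subseteq> {1..n}" "a \<in> carrier W"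
  shows "0 < mat_pow (carrier W) P (length u) a (a \<star> elt u)"
  using assms(3,4)
proof (induction u arbitrary: a)
  case (Cons i u)
  interpret P: finite_stochastic "carrier W" P by fact
  have "0 < mat_pow (carrier W) P 1 a (a \<star> s i)"
    using Cons.prems step P.pow_1[of a "a \<star> s i"] by simp
  moreover have "0 < mat_pow (carrier W) P (length u) (a \<star> s i) (a \<star> s i \<star> elt u)"
    using Cons by simp
  ultimately have "0 < mat_pow (carrier W) P (1 + length u) a (a \<star> s i \<star> elt u)"
    using Cons.prems by (intro P.pow_pos_trans[of a "a \<star> s i"]) auto
  then show ?case using Cons.prems by (simp add: m_assoc One_nat_def del: mat_pow.simps)
qed simp

text \<open>Follow a reduced word from \<open>a\<close> to \<open>b\<close>, and spend the remaining even number of steps on going back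
  and forth along one generator.\<close>

lemma pow_pos_parity:
  assumes P: "finite_stochastic (carrier W) P"
    and step: "\<And>a i. a \<in> carrier W \<Longrightarrow> i \<in> {1..n} \<Longrightarrow> 0 < P a (a \<star> s i)"
    and n: "1 \<le> n" and a: "a \<in> carrier W" and b: "b \<in> carrier W"
    and long: "len (inv\<^bsub>W\<^esub> a \<star> b) \<le> k"
    and parity: "even k \<longleftrightarrow> (even (len a) \<longleftrightarrow> even (len b))"
  shows "0 < mat_pow (carrier W) P k a b"
proof -
  have ab: "inv\<^bsub>W\<^esub> a \<star> b \<in> carrier W" "a \<star> (inv\<^bsub>W\<^esub> a \<star> b) = b"
    using a b by (simp_all flip: m_assoc)
  obtain u where u: "set u \<subseteq> {1..n}" "elt u = inv\<^bsub>W\<^esub> a \<star> b" "length u = len (inv\<^bsub>W\<^esub> a \<star> b)"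
    using reduced_word ab(1) .
  have "even (k - length u)"
    using parity even_len_mult[OF a ab(1)] ab(2) long u(3) by auto
  then obtain q where q: "k - length u = 2 * q" by blast
  let ?v = "u @ concat (replicate q [1, 1])"
  have rep: "set (concat (replicate q [1, 1 :: nat])) \<subseteq> {1..n}" using n by auto
  have "elt (concat (replicate q [1, 1])) = \<one>\<^bsub>W\<^esub>"
    using n by (induction q) auto
  then have "a \<star> elt ?v = b" using u(1,2) rep ab by simp
  moreover have "length ?v = k"
    using q long u(3) by (simp add: length_concat sum_list_replicate)
  moreover have "set ?v \<subseteq> {1..n}" using u(1) rep by simp
  ultimately show ?thesis using pow_pos_along_word[OF P step, of ?v a] a by simp
qed

text \<open>The two colours are the parities of the length.\<close>

lemma expected_len_tendsto:
  assumes fin: "finite (carrier W)" and "n \<noteq> 1"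
    and "\<And>k. odd k \<Longrightarrow> 3 \<le> k \<Longrightarrow> \<not> type_I2 k n m"
    and ds: "doubly_stochastic_on (carrier W) P"
    and step: "\<And>a i. a \<in> carrier W \<Longrightarrow> i \<in> {1..n} \<Longrightarrow> 0 < P a (a \<star> s i)"
  shows "(\<lambda>k. mat_apply (carrier W) (mat_pow (carrier W) P k) (\<lambda>w. real (len w)) \<one>\<^bsub>W\<^esub>)
    \<longlonglongrightarrow> real (card (reflections n m)) / 2"
proof (cases "n = 0")
  case True
  have "carrier W = {\<one>\<^bsub>W\<^esub>}"
  proof -
    have "w = \<one>\<^bsub>W\<^esub>" if w: "w \<in> carrier W" for w
    proof -
      obtain u where u: "set u \<subseteq> {1..n}" "elt u = w" using carrier_elt w .
      then have "u = []" using True by simp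
      then show ?thesis using u(2) by simp
    qed
    then show ?thesis by auto
  qed
  moreover have "reflections n m = {}" using True by (auto simp: reflections_def)
  ultimately show ?thesis by (simp add: mat_apply_def)
next
  case False
  then have n: "2 \<le> n" using assms(2) by linarith
  define c where "c = real (card (reflections n m)) / 2"
  have P: "finite_stochastic (carrier W) P"
    using fin ds by unfold_locales (auto simp: stochastic_on_def doubly_stochastic_on_def)
  interpret P: finite_stochastic "carrier W" P by (rule P)
  obtain i j d where ij: "i \<in> {1..n}" "j \<in> {1..n}" "i \<noteq> j" "m i j = enat d" "even d"
    using even_pair[OF fin n assms(3)] .
  obtain w0 where "\<And>w. w \<in> carrier W \<Longrightarrow> w \<noteq> w0 \<Longrightarrow> len w < len w0"
    using longest_element[OF fin] by blast
  then have w0: "len w \<le> len w0" if "w \<in> carrier W" for w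
    using that by (cases "w = w0") (auto simp: less_imp_le)
  have "(\<lambda>k. mat_apply (carrier W) (mat_pow (carrier W) P k) (\<lambda>w. real (len w) - c) \<one>\<^bsub>W\<^esub>)
      \<longlonglongrightarrow> 0"
  proof (rule doubly_stochastic_powers_vanish[OF fin ds, of "len w0" "\<lambda>w. even (len w)"])
    fix k a b
    assume "len w0 \<le> k" "a \<in> carrier W" "b \<in> carrier W" "even k = (even (len a) = even (len b))"
    then show "0 < mat_pow (carrier W) P k a b"
      using n w0[of "inv\<^bsub>W\<^esub> a \<star> b"] by (intro pow_pos_parity P step) auto
  next
    show "(\<Sum>w\<in>{w \<in> carrier W. even (len w) = q}. real (len w) - c) = 0" for q
      unfolding c_def by (rule sum_parity_class[OF fin ij])
  qed simp
  moreover have "mat_apply (carrier W) (mat_pow (carrier W) P k) (\<lambda>w. real (len w) - c) \<one>\<^bsub>W\<^esub>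
      = mat_apply (carrier W) (mat_pow (carrier W) P k) (\<lambda>w. real (len w)) \<one>\<^bsub>W\<^esub> - c" for k
    using P.pow_row_sum[of "\<one>\<^bsub>W\<^esub>" k]
    by (simp add: mat_apply_def right_diff_distrib sum_subtractf flip: sum_distrib_right)
  ultimately show ?thesis unfolding c_def[symmetric] by (simp add: LIM_zero_cancel)
qed

end

theorem proposition4p1:
  fixes n :: nat and m :: "nat \<Rightarrow> nat \<Rightarrow> enat"
    and P :: "letter list set \<Rightarrow> letter list set \<Rightarrow> real"
    and M :: "'o measure" and X :: "nat \<Rightarrow> 'o \<Rightarrow> letter list set"
  assumes "coxeter_matrix n m"
    and "finite (carrier (coxeter_group n m))"
    and "\<not> type_A1 n m"
    and "\<And>k. odd k \<Longrightarrow> 3 \<le> k \<Longrightarrow> \<not> type_I2 k n m"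
    and "doubly_stochastic_on (carrier (coxeter_group n m)) P"
    and "random_walk n m P M X"
  shows "((\<lambda>k. prob_space.expectation M (\<lambda>\<omega>. real (braid_length n m (braid_lift n m (X k \<omega>)))))
            \<longlonglongrightarrow> real (card (reflections n m)) / 2) \<and>
         (\<exists>w0\<in>carrier (coxeter_group n m).
            (\<forall>w\<in>carrier (coxeter_group n m). w \<noteq> w0 \<longrightarrow> cox_length n m w < cox_length n m w0) \<and>
            card (reflections n m) = cox_length n m w0)"
proof
  let ?W = "coxeter_group n m"
  interpret coxeter n m by unfold_locales (rule assms(1))
  interpret chain: finite_markov_chain M "carrier ?W" "\<one>\<^bsub>?W\<^esub>" P X
    using assms(2,6) by unfold_locales (auto simp: random_walk_def)
  have "n \<noteq> 1" using assms(1,3) by (simp add: type_A1_def)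
  then have "(\<lambda>k. mat_apply (carrier ?W) (mat_pow (carrier ?W) P k)
      (\<lambda>w. real (cox_length n m w)) \<one>\<^bsub>?W\<^esub>) \<longlonglongrightarrow> real (card (reflections n m)) / 2"
    using assms(6) by (intro expected_len_tendsto assms(2,4,5)) (auto simp: random_walk_def)
  moreover have "chain.expectation (\<lambda>\<omega>. real (braid_length n m (braid_lift n m (X k \<omega>))))
      = mat_apply (carrier ?W) (mat_pow (carrier ?W) P k) (\<lambda>w. real (cox_length n m w)) \<one>\<^bsub>?W\<^esub>" for k
    unfolding chain.expectation_eq[symmetric]
    by (intro Bochner_Integration.integral_cong) (simp_all add: braid_length_lift chain.X_in)
  ultimately show "(\<lambda>k. chain.expectation (\<lambda>\<omega>. real (braid_length n m (braid_lift n m (X k \<omega>)))))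
      \<longlonglongrightarrow> real (card (reflections n m)) / 2"
    by simp
  show "\<exists>w0\<in>carrier ?W. (\<forall>w\<in>carrier ?W. w \<noteq> w0 \<longrightarrow> cox_length n m w < cox_length n m w0) \<and>
      card (reflections n m) = cox_length n m w0"
    using longest_element[OF assms(2)] by metis
qed

end
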